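(* Let $K$ be a field, let $(L,\rho)$ be a partial character on $\mathbb{Z}^m$ with $L$ a non-zero positive sublattice of $\mathbb{Z}^m$, let $\mathbf{u}_1,\ldots,\mathbf{u}_q$ be elements of the lattice $L$, and let $\sigma_L=pos_{\mathbb{Q}}(A)$ be the rational polyhedral cone associated to the lattice ideal $I_{L,\rho}\subset K[x_1,\ldots,x_m]$. Then $$rad(I_{L,\rho})=rad(B(\mathbf{u}_1),B(\mathbf{u}_2),\ldots,B(\mathbf{u}_q))$$ if and only if both of the following conditions hold: (i) $\{B(\mathbf{u}_1),B(\mathbf{u}_2),\ldots,B(\mathbf{u}_q)\}$ is a cover of $A$; (ii) for every face $\mathcal{F}$ of $\sigma_L$ we have, if $K$ has characteristic zero, $$L\cap\mathbb{Z}^{\mathbb{E}_{\mathcal{F}}}=\sum_{\mathbf{u}_i\in\mathbb{Z}^{\mathbb{E}_{\mathcal{F}}}}\mathbb{Z}\mathbf{u}_i,$$ while, if $K$ has characteristic $p>0$, $$(L\cap\mathbb{Z}^{\mathbb{E}_{\mathcal{F}}}):p^{\infty}=\Big(\sum_{\mathbf{u}_i\in\mathbb{Z}^{\mathbb{E}_{\mathcal{F}}}}\mathbb{Z}\mathbf{u}_i\Big):p^{\infty}.$$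
   Context: A partial character $(L,\rho)$ on $\mathbb{Z}^m$ is a homomorphism $\rho$ from a sublattice (subgroup) $L$ of $\mathbb{Z}^m$ to the multiplicative group $K^*=K\setminus\{0\}$. The lattice $L$ is positive if $L\cap\mathbb{N}^m=\{\mathbf{0}\}$. Every $\mathbf{u}\in\mathbb{Z}^m$ is written uniquely as $\mathbf{u}=\mathbf{u}_+-\mathbf{u}_-$ with $\mathbf{u}_+,\mathbf{u}_-$ non-negative with disjoint supports, where ${\rm supp}(\mathbf{u})=\{i: u_i\neq 0\}$. For $\mathbf{u}\in L$ put $B(\mathbf{u}):=\mathbf{x}^{\mathbf{u}_+}-\rho(\mathbf{u})\mathbf{x}^{\mathbf{u}_-}\in K[x_1,\ldots,x_m]$. The lattice ideal $I_{L,\rho}$ is the ideal generated by all $B(\mathbf{u})$, $\mathbf{u}\in L$. The saturation of $L$ is $Sat(L)=\{\alpha\in\mathbb{Z}^m : d\alpha\in L \text{ for some } d\in\mathbb{Z}, d\neq 0\}$. Let $n=m-rank(L)$, fix an isomorphism $\psi:\mathbb{Z}^m/Sat(L)\to\mathbb{Z}^n$, and put $\mathbf{a}_i=\psi(\mathbf{e}_i+Sat(L))$ for $1\le i\le m$, where $\mathbf{e}_1,\dots,\mathbf{e}_m$ are the unit vectors of $\mathbb{Z}^m$. The configuration of vectors associated to $L$ is $A=\{\mathbf{a}_1,\ldots,\mathbf{a}_m\}$ (indexed by $1,\dots,m$), and $\sigma_L=pos_{\mathbb{Q}}(A)=\{\lambda_1\mathbf{a}_1+\cdots+\lambda_m\mathbf{a}_m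 : \lambda_i\in\mathbb{Q},\ \lambda_i\ge 0\}\subset\mathbb{Q}^n$. A face of $\sigma_L$ is a set of the form $\sigma_L\cap\{\mathbf{x}\in\mathbb{Q}^n:\mathbf{c}\mathbf{x}=0\}$ where $\mathbf{c}\in\mathbb{Q}^n$ and $\mathbf{c}\mathbf{x}\ge 0$ for all $\mathbf{x}\in\sigma_L$ (so $\sigma_L$ itself is a face). For $S\subset\sigma_L$, $\mathbb{E}_S:=\{i\in\{1,\ldots,m\}:\mathbf{a}_i\in S\}$. For $E\subset\{1,\ldots,m\}$, $\mathbb{Z}^E:=\{\mathbf{u}\in\mathbb{Z}^m:{\rm supp}(\mathbf{u})\subset E\}$. A set of binomials $\{B(\mathbf{u}_1),\ldots,B(\mathbf{u}_q)\}\subset I_{L,\rho}$ (with $\mathbf{u}_i\in L$) is a cover of $A$ if for every $E\subset\{1,\ldots,m\}$ that is not of the form $\mathbb{E}_{\mathcal{F}}$ for a face $\mathcal{F}$ of $\sigma_L$, there exists $i\in\{1,\ldots,q\}$ such that either $(\mathbf{u}_i)_+\in\mathbb{Z}^E$ and $(\mathbf{u}_i)_-\notin\mathbb{Z}^E$, or $(\mathbf{u}_i)_-\in\mathbb{Z}^E$ and $(\mathbf{u}_i)_+\notin\mathbb{Z}^E$. For a prime $p$ and a sublattice $M\subset\mathbb{Z}^m$, $M:p^{\infty}:=\{\alpha\in\mathbb{Z}^m : p^k\alpha\in M\text{ for some }k\in\mathbb{N}\}$. Empty sums of lattices are the zero lattice. *)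

theory Defs
  imports
    "HOL-Analysis.Analysis"
    "HOL-Algebra.Coset"
    "HOL-Library.Poly_Mapping"
begin

section \<open>Lattices and partial characters\<close>

text \<open>
  The group \<open>\<int>\<^sup>m\<close> is the type \<open>int ^ 'm\<close>, whose finite index type \<open>'m\<close> plays the role of
  \<open>{1,\<dots>,m}\<close>. As in \<open>integer_group\<close>, it is packaged as a monoid record so that subgroups,
  homomorphisms and quotients are those of HOL-Algebra.
\<close>

definition int_vec_group :: "(int ^ 'm) monoid" where
  "int_vec_group = \<lparr>carrier = UNIV, monoid.mult = (+), one = 0\<rparr>"

definition units_group :: "'k::field monoid" where
  "units_group = \<lparr>carrier = UNIV - {0}, monoid.mult = (*), one = 1\<rparr>"

definition partial_character :: "(int ^ 'm) set \<Rightarrow> (int ^ 'm \<Rightarrow> 'k::field) \<Rightarrow> bool" where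
  "partial_character L \<rho> \<longleftrightarrow>
     subgroup L int_vec_group \<and> \<rho> \<in> hom (int_vec_group\<lparr>carrier := L\<rparr>) units_group"

definition positive_lattice :: "(int ^ 'm) set \<Rightarrow> bool" where
  "positive_lattice L \<longleftrightarrow> L \<inter> {v. \<forall>i. 0 \<le> v $ i} = {0}"

definition saturation :: "(int ^ 'm) set \<Rightarrow> (int ^ 'm) set" where
  "saturation L = {\<alpha>. \<exists>d::int. d \<noteq> 0 \<and> d *s \<alpha> \<in> L}"

definition lattice_colon :: "(int ^ 'm) set \<Rightarrow> nat \<Rightarrow> (int ^ 'm) set" where
  "lattice_colon M p = {\<alpha>. \<exists>k. int p ^ k *s \<alpha> \<in> M}"

definition rat_vec :: "int ^ 'm \<Rightarrow> rat ^ 'm" where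
  "rat_vec v = (\<chi> i. rat_of_int (v $ i))"

text \<open>The rank of a lattice is the dimension of its \<open>\<rat>\<close>-span (\<open>vec.dim S\<close> is the dimension of
  the linear span of \<open>S\<close>).\<close>

definition lattice_rank :: "(int ^ 'm) set \<Rightarrow> nat" where
  "lattice_rank L = vec.dim (rat_vec ` L)"

definition supp :: "int ^ 'm \<Rightarrow> 'm set" where
  "supp v = {i. v $ i \<noteq> 0}"

definition pos_part :: "int ^ 'm \<Rightarrow> int ^ 'm" where
  "pos_part v = (\<chi> i. max (v $ i) 0)"

definition neg_part :: "int ^ 'm \<Rightarrow> int ^ 'm" where
  "neg_part v = (\<chi> i. max (- (v $ i)) 0)"

definition coord_lattice :: "'m set \<Rightarrow> (int ^ 'm) set" where
  "coord_lattice E = {v. supp v \<subseteq> E}"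

text \<open>The lattice \<open>\<Sum>\<^bsub>i \<in> I\<^esub> \<int> u\<^sub>i\<close>, for a finite index set \<open>I\<close>.\<close>

definition sum_lattice :: "('i \<Rightarrow> int ^ 'm) \<Rightarrow> 'i set \<Rightarrow> (int ^ 'm) set" where
  "sum_lattice u I = {\<Sum>i\<in>I. c i *s u i | c. True}"


section \<open>Polynomials, ideals and lattice ideals\<close>

text \<open>
  The polynomial ring \<open>K[x\<^sub>i | i \<in> 'm]\<close> is the monoid algebra of the finitely supported exponent
  vectors \<open>'m \<Rightarrow>\<^sub>0 nat\<close>; its multiplication is the convolution product of \<open>poly_mapping\<close>.
\<close>

type_synonym ('m, 'k) mpoly = "('m \<Rightarrow>\<^sub>0 nat) \<Rightarrow>\<^sub>0 'k"

definition mvar :: "'m \<Rightarrow> ('m, 'k::field) mpoly" where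
  "mvar i = Poly_Mapping.single (Poly_Mapping.single i 1) 1"

definition mconst :: "'k \<Rightarrow> ('m, 'k::field) mpoly" where
  "mconst c = Poly_Mapping.single 0 c"

text \<open>Used only for vectors with non-negative entries.\<close>

definition monomial_of :: "int ^ 'm \<Rightarrow> ('m, 'k::field) mpoly" where
  "monomial_of v = (\<Prod>i\<in>UNIV. mvar i ^ nat (v $ i))"

definition binomial_of :: "(int ^ 'm \<Rightarrow> 'k::field) \<Rightarrow> int ^ 'm \<Rightarrow> ('m, 'k) mpoly" where
  "binomial_of \<rho> v = monomial_of (pos_part v) - mconst (\<rho> v) * monomial_of (neg_part v)"

text \<open>An ideal is a submodule of the ring over itself.\<close>

definition ideal_gen :: "'a::comm_ring_1 set \<Rightarrow> 'a set" where
  "ideal_gen S = module.span (*) S"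

definition ideal_radical :: "'a::comm_ring_1 set \<Rightarrow> 'a set" where
  "ideal_radical I = {f. \<exists>n>0. f ^ n \<in> I}"

definition lattice_ideal :: "(int ^ 'm) set \<Rightarrow> (int ^ 'm \<Rightarrow> 'k::field) \<Rightarrow> ('m, 'k) mpoly set" where
  "lattice_ideal L \<rho> = ideal_gen (binomial_of \<rho> ` L)"


section \<open>The vector configuration and its cone\<close>

text \<open>
  \<open>configuration L \<psi> i\<close> is the image under \<open>\<psi> : \<int>\<^sup>m / Sat(L) \<rightarrow> \<int>\<^sup>n\<close> of the coset of the unit
  vector \<open>e\<^sub>i\<close>. A configuration is kept as an indexed family, since the \<open>a\<^sub>i\<close> may coincide.
\<close>

definition configuration :: "(int ^ 'm) set \<Rightarrow> ((int ^ 'm) set \<Rightarrow> int ^ 'n) \<Rightarrow> 'm \<Rightarrow> int ^ 'n" where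
  "configuration L \<psi> i = \<psi> (saturation L #>\<^bsub>int_vec_group\<^esub> axis i 1)"

definition rat_cone :: "('m::finite \<Rightarrow> int ^ 'n) \<Rightarrow> (rat ^ 'n) set" where
  "rat_cone a = {\<Sum>i\<in>UNIV. l i *s rat_vec (a i) | l. \<forall>i. 0 \<le> l i}"

definition is_face :: "(rat ^ 'n) set \<Rightarrow> (rat ^ 'n) set \<Rightarrow> bool" where
  "is_face \<sigma> F \<longleftrightarrow>
     (\<exists>c. (\<forall>x\<in>\<sigma>. 0 \<le> scalar_product c x) \<and> F = \<sigma> \<inter> {x. scalar_product c x = 0})"

definition index_set :: "('m \<Rightarrow> int ^ 'n) \<Rightarrow> (rat ^ 'n) set \<Rightarrow> 'm set" where
  "index_set a S = {i. rat_vec (a i) \<in> S}"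

text \<open>
  The family \<open>u\<close> of lattice vectors, indexed by \<open>I\<close>, stands for the set of binomials \<open>B(u\<^sub>i)\<close>;
  being a cover of the configuration \<open>a\<close> is a condition on the \<open>u\<^sub>i\<close> alone.
\<close>

definition is_cover :: "('m::finite \<Rightarrow> int ^ 'n) \<Rightarrow> ('i \<Rightarrow> int ^ 'm) \<Rightarrow> 'i set \<Rightarrow> bool" where
  "is_cover a u I \<longleftrightarrow>
     (\<forall>E. (\<nexists>F. is_face (rat_cone a) F \<and> E = index_set a F) \<longrightarrow>
       (\<exists>i\<in>I.
          pos_part (u i) \<in> coord_lattice E \<and> neg_part (u i) \<notin> coord_lattice E \<or>
          neg_part (u i) \<in> coord_lattice E \<and> pos_part (u i) \<notin> coord_lattice E))"

end

theory Submission
  imports Defs "HOL-Computational_Algebra.Primes"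
begin

text \<open>
  Call \<open>v \<in> \<int>\<^sup>m\<close> balanced for \<open>E\<close> if \<open>v\<^sub>+ \<in> \<int>\<^sup>E \<longleftrightarrow> v\<^sub>- \<in> \<int>\<^sup>E\<close>. By Farkas' lemma \<open>E\<close> belongs to a
  face of the cone iff all vectors of \<open>L\<close> are balanced for \<open>E\<close>; this removes the cone.

  If (i) and (ii) hold and \<open>P\<close> is a prime ideal containing the \<open>B(u\<^sub>i)\<close>, let \<open>E\<close> be the set of
  indices of the variables outside \<open>P\<close>. The \<open>u\<^sub>i\<close> are balanced for \<open>E\<close>, so by (i) \<open>E\<close> belongs to a
  face. The \<open>v \<in> L \<inter> \<int>\<^sup>E\<close> with \<open>B(v) \<in> P\<close> form a lattice, which by (ii) is all of \<open>L \<inter> \<int>\<^sup>E\<close> (in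
  characteristic \<open>p\<close> by means of \<open>B(p\<^sup>k v) = B(v)^(p\<^sup>k)\<close>), and for \<open>v \<in> L - \<int>\<^sup>E\<close> both monomials of
  \<open>B(v)\<close> lie in \<open>P\<close>.

  Conversely, if all \<open>u\<^sub>i\<close> are balanced for \<open>E\<close>, then for every lattice \<open>M \<subseteq> L\<close> containing the
  \<open>u\<^sub>i \<in> \<int>\<^sup>E\<close> there are linear functionals, supported on the monomials of a coset of \<open>M\<close> in the
  variables \<open>E\<close>, that annihilate the ideal of the \<open>B(u\<^sub>i)\<close>. If (i) or (ii) fails, one of them does not
  annihilate a suitable power of some \<open>B(v)\<close>, \<open>v \<in> L\<close>.
\<close>

subsection \<open>Lattices\<close>

locale int_lattice =
  fixes L :: "(int ^ 'm) set"
  assumes zero_closed: "0 \<in> L"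
    and add_closed: "\<And>x y. x \<in> L \<Longrightarrow> y \<in> L \<Longrightarrow> x + y \<in> L"
    and uminus_closed: "\<And>x. x \<in> L \<Longrightarrow> - x \<in> L"
begin

lemma diff_closed: "x \<in> L \<Longrightarrow> y \<in> L \<Longrightarrow> x - y \<in> L"
  using add_closed[of x "- y"] uminus_closed[of y] by simp

lemma nat_scale_closed: "x \<in> L \<Longrightarrow> int n *s x \<in> L"
  by (induction n) (simp_all add: zero_closed add_closed vec.scale_left_distrib vector_sadd_rdistrib)

lemma scale_closed:
  assumes "x \<in> L"
  shows "c *s x \<in> L"
proof (cases "0 \<le> c")
  case True
  then show ?thesis using nat_scale_closed[OF assms, of "nat c"] by simp
next
  case False
  then have "c *s x = - (int (nat (- c)) *s x)"
    by (simp add: vec_eq_iff)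
  then show ?thesis using uminus_closed[OF nat_scale_closed[OF assms]] by metis
qed

lemma sum_closed: "(\<And>i. i \<in> I \<Longrightarrow> f i \<in> L) \<Longrightarrow> sum f I \<in> L"
  by (induction I rule: infinite_finite_induct) (simp_all add: zero_closed add_closed)

lemma sum_lattice_subset: "(\<And>i. i \<in> I \<Longrightarrow> u i \<in> L) \<Longrightarrow> sum_lattice u I \<subseteq> L"
  by (auto simp: sum_lattice_def intro!: sum_closed scale_closed)

end

lemma int_vec_group_simps [simp]:
  "carrier int_vec_group = UNIV" "x \<otimes>\<^bsub>int_vec_group\<^esub> y = x + y" "\<one>\<^bsub>int_vec_group\<^esub> = 0"
  by (simp_all add: int_vec_group_def)

lemma comm_group_int_vec_group: "comm_group int_vec_group"
proof (rule comm_groupI)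
  show "\<exists>y\<in>carrier int_vec_group. y \<otimes>\<^bsub>int_vec_group\<^esub> x = \<one>\<^bsub>int_vec_group\<^esub>" for x :: "int ^ 'm"
    by (rule bexI[of _ "- x"]) simp_all
qed (simp_all add: ac_simps)

interpretation int_vec: comm_group "int_vec_group :: (int ^ 'm) monoid"
  by (rule comm_group_int_vec_group)

lemma inv_int_vec_group [simp]: "inv\<^bsub>int_vec_group\<^esub> x = - x"
  by (rule int_vec.inv_equality) simp_all

lemma subgroup_int_vec_group_iff: "subgroup L int_vec_group \<longleftrightarrow> int_lattice L"
proof
  assume "subgroup L int_vec_group"
  then interpret subgroup L int_vec_group .
  show "int_lattice L"
    using one_closed m_closed m_inv_closed by unfold_locales simp_all
next
  assume "int_lattice L"
  then interpret int_lattice L .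
  show "subgroup L int_vec_group"
    by (rule int_vec.subgroupI) (use zero_closed add_closed uminus_closed in auto)
qed

lemma vector_uminus_scale: "(- c) *s x = - (c *s x)" for c :: "'a::ring_1"
  by (simp add: vec_eq_iff)

lemma int_lattice_sum_lattice: "int_lattice (sum_lattice u I)"
proof
  show "0 \<in> sum_lattice u I"
    unfolding sum_lattice_def by (rule CollectI, rule exI[of _ "\<lambda>_. 0"]) simp
next
  fix x y assume "x \<in> sum_lattice u I" "y \<in> sum_lattice u I"
  then obtain c d where "x = (\<Sum>i\<in>I. c i *s u i)" "y = (\<Sum>i\<in>I. d i *s u i)"
    by (auto simp: sum_lattice_def)
  then have "x + y = (\<Sum>i\<in>I. (c i + d i) *s u i)"
    by (simp add: sum.distrib vector_sadd_rdistrib)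
  then show "x + y \<in> sum_lattice u I"
    unfolding sum_lattice_def by (intro CollectI exI[of _ "\<lambda>i. c i + d i"]) simp
next
  fix x assume "x \<in> sum_lattice u I"
  then obtain c where "x = (\<Sum>i\<in>I. c i *s u i)"
    by (auto simp: sum_lattice_def)
  then have "- x = (\<Sum>i\<in>I. (- c i) *s u i)"
    by (simp add: vector_uminus_scale sum_negf)
  then show "- x \<in> sum_lattice u I"
    unfolding sum_lattice_def by (intro CollectI exI[of _ "\<lambda>i. - c i"]) simp
qed

lemma sum_lattice_generator: "finite I \<Longrightarrow> i \<in> I \<Longrightarrow> u i \<in> sum_lattice u I"
  unfolding sum_lattice_def
  by (rule CollectI, rule exI[of _ "\<lambda>j. if j = i then 1 else 0"])
    (simp add: if_distrib[of "\<lambda>c. c *s _"] sum.delta cong: if_cong)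

lemma int_lattice_coord_lattice: "int_lattice (coord_lattice E)"
proof
  fix x y assume xy: "x \<in> coord_lattice E" "y \<in> coord_lattice E"
  have "x $ i = 0 \<and> y $ i = 0" if "i \<notin> E" for i
    using xy that by (auto simp: coord_lattice_def supp_def)
  then show "x + y \<in> coord_lattice E"
    by (force simp: coord_lattice_def supp_def)
qed (auto simp: coord_lattice_def supp_def)

lemma int_lattice_Int: "int_lattice L \<Longrightarrow> int_lattice M \<Longrightarrow> int_lattice (L \<inter> M)"
  by (auto simp: int_lattice_def)

lemma (in int_lattice) int_lattice_saturation: "int_lattice (saturation L)"
proof
  show "0 \<in> saturation L"
    unfolding saturation_def using zero_closed by (auto intro: exI[of _ 1])
next
  fix x y assume "x \<in> saturation L" "y \<in> saturation L"
  then obtain c d :: int where *: "c \<noteq> 0" "c *s x \<in> L" "d \<noteq> 0" "d *s y \<in> L"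
    by (auto simp: saturation_def)
  have "(c * d) *s (x + y) = d *s (c *s x) + c *s (d *s y)"
    by (simp add: vector_add_ldistrib mult.commute)
  also have "\<dots> \<in> L"
    by (intro add_closed scale_closed *)
  finally have "(c * d) *s (x + y) \<in> L" .
  then show "x + y \<in> saturation L"
    unfolding saturation_def using * by (auto intro!: exI[of _ "c * d"])
next
  fix x assume "x \<in> saturation L"
  then obtain c :: int where *: "c \<noteq> 0" "c *s x \<in> L"
    by (auto simp: saturation_def)
  then have "(- c) *s (- x) \<in> L"
    by (simp add: vec_eq_iff vector_scalar_mult_def)
  then show "- x \<in> saturation L"
    unfolding saturation_def using * by (intro CollectI exI[of _ "- c"]) simp
qed

lemma (in int_lattice) subset_saturation: "L \<subseteq> saturation L"
  by (auto simp: saturation_def intro: exI[of _ 1])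

section \<open>Bilinearity of the pairing and the embedding of integer vectors into rational
  ones\<close>

lemma scalar_product_add_left: "scalar_product (v + w) x = scalar_product v x + scalar_product w x"
  by (simp add: scalar_product_def algebra_simps sum.distrib)

lemma scalar_product_add_right:
  "scalar_product x (v + w) = scalar_product x v + scalar_product x w"
  by (simp add: scalar_product_def algebra_simps sum.distrib)

lemma scalar_product_scale_right:
  fixes x v :: "'a :: comm_semiring_1 ^ 'n"
  shows "scalar_product x (c *s v) = c * scalar_product x v"
  by (simp add: scalar_product_def sum_distrib_left ac_simps)

lemma scalar_product_sum_left:
  "scalar_product (sum f I) x = (\<Sum>i\<in>I. scalar_product (f i) x)"
  by (induction I rule: infinite_finite_induct)
    (simp_all add: scalar_product_add_left scalar_product_def[of 0])

lemma scalar_product_sum_right: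
  "scalar_product x (sum f I) = (\<Sum>i\<in>I. scalar_product x (f i))"
  by (induction I rule: infinite_finite_induct)
    (simp_all add: scalar_product_add_right scalar_product_def[of _ 0])

lemma rat_vec_add: "rat_vec (x + y) = rat_vec x + rat_vec y"
  by (simp add: rat_vec_def vec_eq_iff)

lemma rat_vec_0: "rat_vec 0 = 0"
  by (simp add: rat_vec_def vec_eq_iff)

lemma rat_vec_scale: "rat_vec (c *s x) = of_int c *s rat_vec x"
  by (simp add: rat_vec_def vec_eq_iff)

lemma rat_vec_sum: "rat_vec (sum f I) = (\<Sum>i\<in>I. rat_vec (f i))"
  by (induction I rule: infinite_finite_induct) (simp_all add: rat_vec_add rat_vec_0)

subsection \<open>A theorem of the alternative\<close>

text \<open>A basis of \<open>S\<close> stays independent when \<open>x\<close> is added, so some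
  linear functional is 0 on the basis and 1 at \<open>x\<close>.\<close>

lemma separating_functional:
  fixes S :: "('a::field ^ 'm) set"
  assumes S: "vec.subspace S" and x: "x \<notin> S"
  obtains w where "\<And>v. v \<in> S \<Longrightarrow> scalar_product w v = 0" "scalar_product w x = 1"
proof -
  interpret pair: vector_space_pair "(*s) :: 'a \<Rightarrow> 'a ^ 'm \<Rightarrow> 'a ^ 'm" "(*) :: 'a \<Rightarrow> 'a \<Rightarrow> 'a" ..
  obtain B where B: "B \<subseteq> S" "vec.independent B" "S \<subseteq> vec.span B"
    using vec.maximal_independent_subset[of S] by metis
  have "vec.span B \<subseteq> S"
    using B(1) S by (rule vec.span_minimal)
  then have x': "x \<notin> vec.span B"
    using x by blast
  have "vec.independent (insert x B)"
    using x' B(2) by (rule vec.independent_insertI)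
  from pair.linear_independent_extend[OF this, of "\<lambda>b. if b = x then 1 else 0"]
  obtain f where f: "Vector_Spaces.linear (*s) (*) f"
    and fB: "\<And>b. b \<in> insert x B \<Longrightarrow> f b = (if b = x then 1 else 0)"
    by blast
  have f0: "f v = 0" if "v \<in> S" for v
  proof (rule pair.linear_eq_0_on_span[OF f, of B])
    show "v \<in> vec.span B" using that B(3) by blast
    show "f b = 0" if "b \<in> B" for b
      using fB[of b] that x' vec.span_base[of x B] by auto
  qed
  \<comment> \<open>A functional on a coordinate space is the pairing with its values at the unit
    vectors.\<close>
  have rep: "f v = scalar_product (\<chi> i. f (axis i 1)) v" for v
  proof -
    have "f v = f (\<Sum>i\<in>UNIV. v $ i *s axis i 1)"
      by (simp add: basis_expansion)
    also have "\<dots> = (\<Sum>i\<in>UNIV. v $ i * f (axis i 1))"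
      by (simp add: pair.linear_sum[OF f] pair.linear_scale[OF f])
    finally show ?thesis
      by (simp add: scalar_product_def mult.commute)
  qed
  show thesis
    using that[of "\<chi> i. f (axis i 1)"] f0 fB[of x] by (simp flip: rep)
qed

text \<open>Minty's form of Farkas' lemma. In the induction step the new index is first added to \<open>E\<close> and
  then to \<open>H\<close>; if both induction hypotheses give the wrong sign there, orthogonality of the two
  vectors fails.\<close>

lemma Minty_alternative:
  fixes S :: "('a::linordered_field ^ 'm) set"
  assumes S: "vec.subspace S" and "finite G"
    and "insert t (E \<union> G \<union> H) = UNIV" "t \<notin> E \<union> G \<union> H"
    and "E \<inter> G = {}" "E \<inter> H = {}" "G \<inter> H = {}"
  shows "(\<exists>v\<in>S. v $ t = 1 \<and> (\<forall>i\<in>H. v $ i = 0) \<and> (\<forall>i\<in>G. 0 \<le> v $ i)) \<or>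
    (\<exists>w. (\<forall>v\<in>S. scalar_product w v = 0) \<and> w $ t = 1 \<and> (\<forall>i\<in>E. w $ i = 0) \<and> (\<forall>i\<in>G. 0 \<le> w $ i))"
  using assms(2-)
proof (induction G arbitrary: E H rule: finite_induct)
  case empty
  \<comment> \<open>Without sign conditions the question is whether the unit vector at
    \<open>t\<close> lies in the sum of \<open>S\<close> and the coordinate subspace of
    \<open>E\<close>. If it does, its \<open>S\<close>-component is the required \<open>v\<close>;
    if not, a separating functional is the required \<open>w\<close>.\<close>
  let ?T = "vec.span ((\<lambda>i. axis i 1) ` E) :: ('a ^ 'm) set"
  let ?U = "{x + y | x y. x \<in> S \<and> y \<in> ?T}"
  have sub: "vec.subspace ?U"
    using S by (intro vec.subspace_sums) simp_all
  have T: "y $ i = 0" if "y \<in> ?T" "i \<notin> E" for y i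
    using that(1) by (induction rule: vec.span_induct_alt) (use that(2) in \<open>auto simp: axis_def split: if_splits\<close>)
  show ?case
  proof (cases "axis t 1 \<in> ?U")
    case True
    then obtain x y where xy: "x \<in> S" "y \<in> ?T" "axis t 1 = x + y"
      by blast
    have x: "x $ i = (if i = t then 1 else 0)" if "i \<notin> E" for i
      using T[OF xy(2) that] arg_cong[OF xy(3), of "\<lambda>y. y $ i"] by (auto simp: axis_def)
    have "x $ t = 1"
      using x empty.prems by auto
    moreover have "x $ i = 0" if "i \<in> H" for i
    proof -
      have "i \<notin> E" "i \<noteq> t"
        using empty.prems that by blast+
      then show ?thesis
        by (simp add: x)
    qed
    ultimately show ?thesis
      by (intro disjI1 bexI[of _ x] xy(1)) simp
  next
    case False
    from separating_functional[OF sub False] obtain w where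
      w: "\<And>v. v \<in> ?U \<Longrightarrow> scalar_product w v = 0" and wt: "scalar_product w (axis t 1) = 1"
      by blast
    have ax: "scalar_product w (axis i 1) = w $ i" for i
      by (simp add: scalar_product_def axis_def if_distrib sum.delta' cong: if_cong)
    have "scalar_product w v = 0" if "v \<in> S" for v
    proof (rule w)
      have "v = v + 0" "0 \<in> ?T"
        by (simp_all add: vec.span_zero)
      then show "v \<in> ?U"
        using that by blast
    qed
    moreover have "w $ i = 0" if "i \<in> E" for i
    proof -
      have "axis i 1 \<in> ?T"
        using that by (intro vec.span_base) blast
      moreover have "axis i 1 = 0 + (axis i 1 :: 'a ^ 'm)" "0 \<in> S"
        by (simp_all add: vec.subspace_0[OF S])
      ultimately have "axis i 1 \<in> ?U"
        by blast
      then show ?thesis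
        using w[of "axis i 1"] ax[of i] by simp
    qed
    ultimately show ?thesis
      using wt ax[of t] by (intro disjI2 exI[of _ w]) simp
  qed
next
  case (insert g G)
  let ?v = "\<lambda>H v. v \<in> S \<and> v $ t = 1 \<and> (\<forall>i\<in>H. v $ i = 0) \<and> (\<forall>i\<in>G. 0 \<le> v $ i)"
  let ?w = "\<lambda>E w. (\<forall>v\<in>S. scalar_product w v = 0) \<and> w $ t = 1 \<and> (\<forall>i\<in>E. w $ i = 0) \<and> (\<forall>i\<in>G. 0 \<le> w $ i)"
  have eqs: "insert t (insert g E \<union> G \<union> H) = UNIV" "insert t (E \<union> G \<union> insert g H) = UNIV"
    using insert.prems(1) by blast+
  have "(\<exists>v\<in>S. v $ t = 1 \<and> (\<forall>i\<in>H. v $ i = 0) \<and> (\<forall>i\<in>G. 0 \<le> v $ i)) \<or> (\<exists>w. ?w (insert g E) w)"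
    by (rule insert.IH[OF eqs(1)]) (use insert.prems(2-) insert.hyps in blast)+
  then have 1: "(\<exists>v. ?v H v) \<or> (\<exists>w. ?w (insert g E) w)"
    by blast
  have "(\<exists>v\<in>S. v $ t = 1 \<and> (\<forall>i\<in>insert g H. v $ i = 0) \<and> (\<forall>i\<in>G. 0 \<le> v $ i)) \<or> (\<exists>w. ?w E w)"
    by (rule insert.IH[OF eqs(2)]) (use insert.prems(2-) insert.hyps in blast)+
  then have 2: "(\<exists>v. ?v (insert g H) v) \<or> (\<exists>w. ?w E w)"
    by blast
  show ?case
  proof (rule ccontr)
    assume neg: "\<not> ?case"
    from neg have "\<not> (\<exists>w. ?w (insert g E) w)"
      by auto
    moreover from neg have "\<not> (\<exists>v. ?v (insert g H) v)"
      by auto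
    moreover note 1 2
    ultimately obtain v w where v: "?v H v" and w: "?w E w"
      by blast
    \<comment> \<open>A non-negative entry at \<open>g\<close> would make \<open>v\<close> a
      solution of the first alternative for \<open>insert g G\<close>; likewise \<open>w\<close> for
      the second.\<close>
    have vg: "v $ g < 0"
      by (rule ccontr) (use neg v in \<open>auto simp: not_less\<close>)
    have wg: "w $ g < 0"
      by (rule ccontr) (use neg w in \<open>auto simp: not_less\<close>)
    \<comment> \<open>The product is 1 at \<open>t\<close>, vanishes on \<open>E\<close> and on
      \<open>H\<close>, has non-negative factors on \<open>G\<close>, and two negative factors at
      \<open>g\<close>.\<close>
    have sgn: "0 \<le> w $ i * v $ i" for i
    proof -
      have "i = t \<or> i \<in> E \<or> i \<in> H \<or> i \<in> G \<or> i = g"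
        using insert.prems(1) by blast
      then show ?thesis
        using v w vg wg by (auto simp: mult_nonpos_nonpos)
    qed
    have "(0::'a) < (\<Sum>i\<in>UNIV. w $ i * v $ i)"
      by (rule sum_pos2[of _ t]) (use v w sgn in auto)
    then show False
      using v w by (auto simp: scalar_product_def)
  qed
qed

subsection \<open>Faces and balanced vectors\<close>

text \<open>The negation is word for word the condition that \<open>is_cover\<close> asks of some
  \<open>u i\<close>.\<close>

definition balanced :: "'m set \<Rightarrow> int ^ 'm \<Rightarrow> bool" where
  "balanced E v \<longleftrightarrow> (pos_part v \<in> coord_lattice E \<longleftrightarrow> neg_part v \<in> coord_lattice E)"

lemma pos_part_nonneg: "0 \<le> pos_part v $ i" and neg_part_nonneg: "0 \<le> neg_part v $ i"
  by (simp_all add: pos_part_def neg_part_def)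

lemma pos_part_diff_neg_part: "pos_part v - neg_part v = v"
  by (auto simp: pos_part_def neg_part_def vec_eq_iff max_def)

lemma pos_part_uminus: "pos_part (- v) = neg_part v" and neg_part_uminus: "neg_part (- v) = pos_part v"
  by (simp_all add: pos_part_def neg_part_def)

lemma coord_lattice_parts_iff:
  "pos_part v \<in> coord_lattice E \<and> neg_part v \<in> coord_lattice E \<longleftrightarrow> v \<in> coord_lattice E"
proof -
  have "v $ i = 0 \<longleftrightarrow> pos_part v $ i = 0 \<and> neg_part v $ i = 0" for i
    by (auto simp: pos_part_def neg_part_def max_def)
  then show ?thesis
    by (auto simp: coord_lattice_def supp_def)
qed

lemma coord_lattice_add_iff:
  assumes "\<And>i. 0 \<le> v $ i" "\<And>i. 0 \<le> w $ i"
  shows "v + w \<in> coord_lattice E \<longleftrightarrow> v \<in> coord_lattice E \<and> w \<in> coord_lattice E"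
proof -
  have "(v + w) $ i = 0 \<longleftrightarrow> v $ i = 0 \<and> w $ i = 0" for i
    using assms[of i] by (simp add: add_nonneg_eq_0_iff)
  then show ?thesis
    by (auto simp: coord_lattice_def supp_def)
qed

lemma coord_lattice_nonneg_iff:
  assumes w: "\<And>i. 0 \<le> w $ i" "\<And>i. w $ i = 0 \<longleftrightarrow> i \<in> E" and v: "\<And>i. 0 \<le> v $ i"
  shows "v \<in> coord_lattice E \<longleftrightarrow> scalar_product w (rat_vec v) = 0"
  using w v by (auto simp: scalar_product_def sum_nonneg_eq_0_iff rat_vec_def coord_lattice_def supp_def)

text \<open>Here \<open>w\<close> plays the role of the values of a supporting functional of the
  cone at the generators; vanishing on \<open>L\<close> expresses that it comes from the quotient by
  the saturation.\<close>

definition lattice_face :: "(int ^ 'm) set \<Rightarrow> 'm set \<Rightarrow> bool" where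
  "lattice_face L E \<longleftrightarrow> (\<exists>w. (\<forall>v\<in>L. scalar_product w (rat_vec v) = 0) \<and>
    (\<forall>i. 0 \<le> w $ i) \<and> (\<forall>i. w $ i = 0 \<longleftrightarrow> i \<in> E))"

lemma (in int_lattice) span_rat_vec_clear_denominators:
  assumes "x \<in> vec.span (rat_vec ` L)"
  obtains n v where "0 < n" "v \<in> L" "of_int n *s x = rat_vec v"
proof -
  have "\<exists>n v. 0 < n \<and> v \<in> L \<and> of_int n *s x = rat_vec v"
    using assms
  proof (induction rule: vec.span_induct_alt)
    case base
    show ?case
      by (rule exI[of _ 1], rule exI[of _ 0]) (simp add: rat_vec_0 zero_closed)
  next
    case (step c y z)
    then obtain n v where n: "0 < n" "v \<in> L" "of_int n *s z = rat_vec v"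
      by blast
    obtain u where u: "u \<in> L" "y = rat_vec u"
      using step by blast
    obtain a b where ab: "c = of_int a / of_int b" "0 < b"
      by (cases c) (auto simp: Fract_of_int_quotient)
    have "of_int (n * b) *s (c *s y + z) = of_int (n * a) *s y + of_int b *s (of_int n *s z)"
      using ab by (simp add: vec_eq_iff field_simps)
    also have "\<dots> = rat_vec ((n * a) *s u + b *s v)"
      by (simp add: u n rat_vec_add rat_vec_scale del: of_int_mult)
    finally show ?case
      using n u ab by (intro exI[of _ "n * b"] exI[of _ "(n * a) *s u + b *s v"])
        (simp add: add_closed scale_closed)
  qed
  then show ?thesis
    using that by blast
qed

text \<open>A weight \<open>w\<close> that vanishes on \<open>L\<close> takes equal values at the
  two parts of \<open>v\<close>, and for non-negative vectors the value 0 detects support in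
  \<open>E\<close>. The converse is Minty's alternative for each index outside
  \<open>E\<close>.\<close>

lemma (in int_lattice) lattice_face_iff_balanced: "lattice_face L E \<longleftrightarrow> (\<forall>v\<in>L. balanced E v)"
proof
  assume "lattice_face L E"
  then obtain w where w: "\<And>v. v \<in> L \<Longrightarrow> scalar_product w (rat_vec v) = 0"
    "\<And>i. 0 \<le> w $ i" "\<And>i. w $ i = 0 \<longleftrightarrow> i \<in> E"
    unfolding lattice_face_def by blast
  show "\<forall>v\<in>L. balanced E v"
  proof
    fix v assume "v \<in> L"
    have "scalar_product w (rat_vec (pos_part v)) = scalar_product w (rat_vec (v + neg_part v))"
      using pos_part_diff_neg_part[of v] by (metis diff_add_cancel)
    also have "\<dots> = scalar_product w (rat_vec (neg_part v))"
      using w(1)[OF \<open>v \<in> L\<close>] by (simp add: rat_vec_add scalar_product_add_right)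
    finally show "balanced E v"
      by (simp add: balanced_def coord_lattice_nonneg_iff[OF w(2,3)] pos_part_nonneg neg_part_nonneg)
  qed
next
  assume bal: "\<forall>v\<in>L. balanced E v"
  let ?S = "vec.span (rat_vec ` L)"
  have "\<exists>w. (\<forall>v\<in>?S. scalar_product w v = 0) \<and> w $ t = 1 \<and> (\<forall>i\<in>E. w $ i = 0) \<and>
    (\<forall>i\<in>- E - {t}. 0 \<le> w $ i)" if t: "t \<notin> E" for t
  proof -
    \<comment> \<open>The first alternative, with \<open>H\<close> empty, is excluded: clearing
      denominators gives a vector of \<open>L\<close> that is non-negative off \<open>E\<close> and
      positive at \<open>t\<close>, hence not balanced.\<close>
    have False if v: "v \<in> ?S" "v $ t = 1" "\<forall>i\<in>- E - {t}. 0 \<le> v $ i" for v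
    proof -
      obtain n x where n: "0 < n" "x \<in> L" "of_int n *s v = rat_vec x"
        using span_rat_vec_clear_denominators[OF v(1)] by blast
      have x: "rat_of_int (x $ i) = of_int n * v $ i" for i
        using arg_cong[OF n(3), of "\<lambda>y. y $ i"] by (simp add: rat_vec_def)
      have "0 \<le> x $ i" if "i \<notin> E" for i
      proof -
        have "0 \<le> v $ i" using v that by (cases "i = t") auto
        then have "0 \<le> rat_of_int (x $ i)" using x n(1) by simp
        then show ?thesis by simp
      qed
      then have "neg_part x \<in> coord_lattice E"
        by (force simp: coord_lattice_def supp_def neg_part_def)
      moreover have "x $ t = n"
        using x[of t] v(2) by simp
      then have "pos_part x \<notin> coord_lattice E"
        using t n(1) by (force simp: coord_lattice_def supp_def pos_part_def)
      ultimately show False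
        using bal n(2) by (auto simp: balanced_def)
    qed
    moreover have "insert t (E \<union> (- E - {t}) \<union> {}) = UNIV" "t \<notin> E \<union> (- E - {t}) \<union> {}"
      "E \<inter> (- E - {t}) = {}" "E \<inter> {} = {}" "(- E - {t}) \<inter> {} = {}"
      using t by auto
    note Minty_alternative[OF vec.subspace_span finite this, of "rat_vec ` L"]
    ultimately show ?thesis
      by blast
  qed
  then obtain W where W: "\<And>t v. t \<notin> E \<Longrightarrow> v \<in> ?S \<Longrightarrow> scalar_product (W t) v = 0"
    "\<And>t. t \<notin> E \<Longrightarrow> W t $ t = 1" "\<And>t i. t \<notin> E \<Longrightarrow> i \<in> E \<Longrightarrow> W t $ i = 0"
    "\<And>t i. t \<notin> E \<Longrightarrow> i \<in> - E - {t} \<Longrightarrow> 0 \<le> W t $ i"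
    by metis
  have W0: "0 \<le> W t $ i" if "t \<notin> E" for t i
    using W(2)[OF that] W(3,4)[OF that, of i] by (cases "i \<in> E"; cases "i = t") auto
  \<comment> \<open>Each \<open>W t\<close> is only known to be positive at \<open>t\<close>; the
    sum is positive at every index outside \<open>E\<close>.\<close>
  let ?w = "\<Sum>t\<in>- E. W t"
  have w: "?w $ i = (\<Sum>t\<in>- E. W t $ i)" for i
    by (rule sum_component)
  have "scalar_product ?w (rat_vec v) = 0" if "v \<in> L" for v
    using W(1) that by (simp add: scalar_product_sum_left vec.span_base)
  moreover have "0 \<le> ?w $ i" for i
    unfolding w using W0 by (intro sum_nonneg) auto
  moreover have "?w $ i = 0 \<longleftrightarrow> i \<in> E" for i
  proof
    assume "i \<in> E"
    then show "?w $ i = 0"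
      unfolding w using W(3) by simp
  next
    assume "?w $ i = 0"
    then have *: "\<And>t. t \<in> - E \<Longrightarrow> W t $ i = 0"
      unfolding w using W0 by (subst (asm) sum_nonneg_eq_0_iff) auto
    show "i \<in> E"
    proof (rule ccontr)
      assume "i \<notin> E"
      then show False using *[of i] W(2)[of i] by simp
    qed
  qed
  ultimately show "lattice_face L E"
    unfolding lattice_face_def by blast
qed

text \<open>Non-negativity on the cone need only be checked at the generators, and
  \<open>index_set\<close> looks at nothing but generators.\<close>

lemma ex_face_iff:
  "(\<exists>F. is_face (rat_cone a) F \<and> E = index_set a F) \<longleftrightarrow>
   (\<exists>c. (\<forall>i. 0 \<le> scalar_product c (rat_vec (a i))) \<and>
     (\<forall>i. scalar_product c (rat_vec (a i)) = 0 \<longleftrightarrow> i \<in> E))"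
proof -
  have mem: "rat_vec (a i) \<in> rat_cone a" for i
    unfolding rat_cone_def
    by (rule CollectI, rule exI[of _ "\<lambda>j. if j = i then 1 else 0"])
      (simp add: if_distrib[of "\<lambda>c. c *s _"] sum.delta cong: if_cong)
  have pos: "(\<forall>x\<in>rat_cone a. 0 \<le> scalar_product c x) \<longleftrightarrow> (\<forall>i. 0 \<le> scalar_product c (rat_vec (a i)))"
    for c
    using mem by (auto simp: rat_cone_def scalar_product_sum_right scalar_product_scale_right
        intro!: sum_nonneg)
  show ?thesis
    unfolding is_face_def pos using mem by (auto simp: index_set_def)
qed

text \<open>Through \<open>\<psi>\<close> the lattice of all integer vectors maps onto the target
  with kernel the saturation of \<open>L\<close>. Functionals on the target therefore correspond to
  those weights \<open>w\<close> that vanish on \<open>L\<close>.\<close>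

lemma (in int_lattice) ex_face_iff_lattice_face:
  assumes psi: "\<psi> \<in> iso (int_vec_group Mod saturation L) int_vec_group"
  shows "(\<exists>F. is_face (rat_cone (configuration L \<psi>)) F \<and> E = index_set (configuration L \<psi>) F) \<longleftrightarrow>
    lattice_face L E"
proof -
  let ?a = "configuration L \<psi>"
  interpret Sat: int_lattice "saturation L"
    by (rule int_lattice_saturation)
  have sub: "subgroup (saturation L) int_vec_group"
    by (simp add: subgroup_int_vec_group_iff int_lattice_saturation)
  interpret N: normal "saturation L" int_vec_group
    using sub by (rule int_vec.subgroup_imp_normal)
  \<comment> \<open>The quotient map followed by \<open>\<psi>\<close>, an additive map that sends
    the unit vectors to the configuration.\<close>
  define A where "A v = \<psi> (saturation L #>\<^bsub>int_vec_group\<^esub> v)" for v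
  have coset: "saturation L #>\<^bsub>int_vec_group\<^esub> v \<in> carrier (int_vec_group Mod saturation L)" for v
    using N.r_coset_hom_Mod by (auto simp: hom_def)
  have A_add: "A (v + w) = A v + A w" for v w
    using N.r_coset_hom_Mod psi coset unfolding A_def iso_def hom_def by auto
  have A_0: "A 0 = 0"
    using A_add[of 0 0] by simp
  have A_uminus: "A (- v) = - A v" for v
    using A_add[of v "- v"] by (simp add: A_0 eq_neg_iff_add_eq_0 add.commute)
  have A_nat: "A (int n *s v) = int n *s A v" for n v
    by (induction n) (simp_all add: A_0 A_add vector_sadd_rdistrib)
  have A_scale: "A (c *s v) = c *s A v" for c v
  proof (cases "0 \<le> c")
    case True
    then show ?thesis using A_nat[of "nat c"] by simp
  next
    case False
    then have "A (c *s v) = A (- (int (nat (- c)) *s v))"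
      by (intro arg_cong[of _ _ A]) (simp add: vec_eq_iff)
    also have "\<dots> = c *s A v"
      unfolding A_uminus A_nat using False by (simp add: vec_eq_iff)
    finally show ?thesis .
  qed
  have A_sum: "A (sum f I) = (\<Sum>i\<in>I. A (f i))" for f and I :: "'i set"
    by (induction I rule: infinite_finite_induct) (simp_all add: A_0 A_add)
  have A_expand: "A v = (\<Sum>i\<in>UNIV. v $ i *s ?a i)" for v
  proof -
    have "A v = A (\<Sum>i\<in>UNIV. v $ i *s axis i 1)"
      by (simp add: basis_expansion)
    also have "\<dots> = (\<Sum>i\<in>UNIV. v $ i *s A (axis i 1))"
      by (simp only: A_sum A_scale)
    finally show ?thesis
      by (simp add: configuration_def A_def)
  qed
  have A_surj: "\<exists>v. A v = y" for y
  proof -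
    have "y \<in> \<psi> ` carrier (int_vec_group Mod saturation L)"
      using psi by (simp add: iso_def bij_betw_def)
    then show ?thesis
      unfolding A_def by (auto simp: FactGroup_def RCOSETS_def)
  qed
  have A_eq_0: "A v = 0 \<longleftrightarrow> v \<in> saturation L" for v
  proof -
    have "A v = A 0 \<longleftrightarrow> saturation L #>\<^bsub>int_vec_group\<^esub> v = saturation L #>\<^bsub>int_vec_group\<^esub> 0"
      unfolding A_def using psi coset by (auto simp: iso_def bij_betw_def dest: inj_onD)
    also have "saturation L #>\<^bsub>int_vec_group\<^esub> 0 = saturation L"
      by (rule int_vec.coset_join2) (simp_all add: sub Sat.zero_closed)
    also have "saturation L #>\<^bsub>int_vec_group\<^esub> v = saturation L \<longleftrightarrow> v \<in> saturation L"
      using int_vec.coset_join1[OF _ _ sub] int_vec.coset_join2[OF _ sub] by auto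
    finally show ?thesis
      by (simp add: A_0)
  qed
  \<comment> \<open>This is the transpose of \<open>A\<close>: the weight with entries
    \<open>c\<close> at the generators is \<open>c\<close> composed with \<open>A\<close>.\<close>
  have pair: "scalar_product (\<chi> i. scalar_product c (rat_vec (?a i))) (rat_vec v) =
      scalar_product c (rat_vec (A v))" for c v
    by (simp add: A_expand rat_vec_sum rat_vec_scale scalar_product_sum_right
        scalar_product_scale_right scalar_product_def[of "vec_lambda _"] rat_vec_def[of v] mult.commute)
  show ?thesis
    unfolding ex_face_iff lattice_face_def
  proof (intro iffI; elim exE conjE)
    fix c assume c: "\<forall>i. 0 \<le> scalar_product c (rat_vec (?a i))"
      "\<forall>i. scalar_product c (rat_vec (?a i)) = 0 \<longleftrightarrow> i \<in> E"
    show "\<exists>w. (\<forall>v\<in>L. scalar_product w (rat_vec v) = 0) \<and> (\<forall>i. 0 \<le> w $ i) \<and> (\<forall>i. w $ i = 0 \<longleftrightarrow> i \<in> E)"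
    proof (rule exI, intro conjI)
      show "\<forall>v\<in>L. scalar_product (\<chi> i. scalar_product c (rat_vec (?a i))) (rat_vec v) = 0"
      proof
        fix v assume "v \<in> L"
        then have "A v = 0"
          using A_eq_0 subset_saturation by blast
        then show "scalar_product (\<chi> i. scalar_product c (rat_vec (?a i))) (rat_vec v) = 0"
          unfolding pair by (simp add: rat_vec_0 scalar_product_def)
      qed
    qed (use c in simp_all)
  next
    fix w :: "rat ^ 'm"
    assume w: "\<forall>v\<in>L. scalar_product w (rat_vec v) = 0" "\<forall>i. 0 \<le> w $ i" "\<forall>i. w $ i = 0 \<longleftrightarrow> i \<in> E"
    \<comment> \<open>To descend \<open>w\<close>, lift the unit vectors of the target along
      \<open>A\<close> and evaluate \<open>w\<close> at the lifts.\<close>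
    obtain r where r: "\<And>k. A (r k) = axis k 1"
      using choice[of "\<lambda>k v. A v = axis k 1"] A_surj by blast
    let ?c = "\<chi> k. scalar_product w (rat_vec (r k))"
    have w_sat: "scalar_product w (rat_vec v) = 0" if "v \<in> saturation L" for v
    proof -
      from that obtain d :: int where d: "d \<noteq> 0" "d *s v \<in> L"
        by (auto simp: saturation_def)
      then have "of_int d * scalar_product w (rat_vec v) = 0"
        using w(1) by (metis rat_vec_scale scalar_product_scale_right)
      then show ?thesis using d by simp
    qed
    have "scalar_product ?c (rat_vec (?a i)) = w $ i" for i
    proof -
      \<comment> \<open>This lift of \<open>?a i\<close> differs from the unit vector at
        \<open>i\<close> by an element of the saturation, where \<open>w\<close> vanishes, so
        \<open>w\<close> takes the same value at both.\<close>
      define v where "v = (\<Sum>k\<in>UNIV. ?a i $ k *s r k)"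
      have "A v = (\<Sum>k\<in>UNIV. ?a i $ k *s axis k 1)"
        by (simp add: v_def A_sum A_scale r)
      also have "\<dots> = A (axis i 1)"
        by (simp add: basis_expansion A_def configuration_def)
      finally have "A (v + - axis i 1) = 0"
        unfolding A_add A_uminus by simp
      then have "scalar_product w (rat_vec (v + - axis i 1)) = 0"
        using A_eq_0 w_sat by blast
      moreover have "scalar_product w (rat_vec v) =
          scalar_product w (rat_vec (v + - axis i 1)) + scalar_product w (rat_vec (axis i 1))"
        by (simp flip: scalar_product_add_right rat_vec_add)
      moreover have "scalar_product w (rat_vec (axis i 1)) = w $ i"
        by (simp add: scalar_product_def rat_vec_def axis_def if_distrib sum.delta' cong: if_cong)
      moreover have "scalar_product w (rat_vec v) = scalar_product ?c (rat_vec (?a i))"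
        by (simp add: v_def rat_vec_sum rat_vec_scale scalar_product_sum_right
            scalar_product_scale_right scalar_product_def[of "vec_lambda _"] rat_vec_def[of "?a i"] mult.commute)
      ultimately show ?thesis by simp
    qed
    then show "\<exists>c. (\<forall>i. 0 \<le> scalar_product c (rat_vec (?a i))) \<and>
        (\<forall>i. scalar_product c (rat_vec (?a i)) = 0 \<longleftrightarrow> i \<in> E)"
      using w(2,3) by (intro exI[of _ ?c]) simp
  qed
qed

subsection \<open>Monomials and binomials\<close>

definition exponent_of :: "int ^ 'm \<Rightarrow> 'm \<Rightarrow>\<^sub>0 nat" where
  "exponent_of v = Abs_poly_mapping (\<lambda>i. nat (v $ i))"

definition vector_of :: "('m \<Rightarrow>\<^sub>0 nat) \<Rightarrow> int ^ 'm" where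
  "vector_of e = (\<chi> i. int (Poly_Mapping.lookup e i))"

lemma lookup_exponent_of [simp]: "Poly_Mapping.lookup (exponent_of v) i = nat (v $ i)"
  by (simp add: exponent_of_def)

lemma exponent_of_vector_of [simp]: "exponent_of (vector_of e) = e"
  by (rule poly_mapping_eqI) (simp add: vector_of_def)

lemma vector_of_nonneg: "0 \<le> vector_of e $ i"
  by (simp add: vector_of_def)

lemma vector_of_exponent_of: "(\<And>i. 0 \<le> v $ i) \<Longrightarrow> vector_of (exponent_of v) = v"
  by (simp add: vector_of_def vec_eq_iff)

lemma vector_of_add: "vector_of (d + e) = vector_of d + vector_of e"
  by (simp add: vector_of_def vec_eq_iff lookup_add)

lemma prod_single: "(\<Prod>i\<in>I. Poly_Mapping.single (f i) 1) = Poly_Mapping.single (sum f I) 1"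
  for f :: "'i \<Rightarrow> 'a::comm_monoid_add"
  by (induction I rule: infinite_finite_induct) (simp_all add: mult_single)

lemma monomial_of_eq_single: "monomial_of v = Poly_Mapping.single (exponent_of v) 1"
proof -
  have pow: "mvar i ^ n = Poly_Mapping.single (Poly_Mapping.single i n) 1" for i :: 'm and n
    by (induction n) (simp_all add: mvar_def mult_single flip: single_add)
  have "(\<Sum>i\<in>UNIV. Poly_Mapping.single i (nat (v $ i))) = exponent_of v"
    by (rule poly_mapping_eqI) (simp add: lookup_sum lookup_single when_def)
  then show ?thesis
    by (simp add: monomial_of_def pow prod_single)
qed

lemma monomial_of_0 [simp]: "monomial_of 0 = 1"
  by (simp add: monomial_of_def)

lemma monomial_of_add:
  assumes "\<And>i. 0 \<le> v $ i" "\<And>i. 0 \<le> w $ i"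
  shows "monomial_of (v + w) = monomial_of v * monomial_of w"
proof -
  have "exponent_of (v + w) = exponent_of v + exponent_of w"
    by (rule poly_mapping_eqI) (simp add: lookup_add assms nat_add_distrib)
  then show ?thesis
    by (simp add: monomial_of_eq_single mult_single)
qed

lemma monomial_of_scale: "(\<And>i. 0 \<le> v $ i) \<Longrightarrow> monomial_of (int n *s v) = monomial_of v ^ n"
  by (induction n) (simp_all add: vector_sadd_rdistrib monomial_of_add)

lemma mconst_mult: "mconst a * mconst b = mconst (a * b)"
  and mconst_power: "mconst a ^ n = mconst (a ^ n)"
  and mconst_1: "mconst 1 = 1"
proof -
  show *: "mconst a * mconst b = mconst (a * b)" for a b
    by (simp add: mconst_def mult_single)
  show 1: "mconst 1 = 1"
    by (simp add: mconst_def)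
  show "mconst a ^ n = mconst (a ^ n)"
    by (induction n) (simp_all add: 1 *)
qed

text \<open>The image of a natural number is the constant polynomial with that coefficient, so it
  vanishes in one ring exactly when it does in the other.\<close>

lemma CHAR_poly_mapping: "CHAR('a::monoid_add \<Rightarrow>\<^sub>0 'b::semiring_1) = CHAR('b)"
proof (rule CHAR_eqI)
  have *: "of_nat n = (0 :: 'a \<Rightarrow>\<^sub>0 'b) \<longleftrightarrow> of_nat n = (0 :: 'b)" for n
  proof
    assume "of_nat n = (0 :: 'a \<Rightarrow>\<^sub>0 'b)"
    then have "Poly_Mapping.lookup (of_nat n :: 'a \<Rightarrow>\<^sub>0 'b) 0 = 0"
      by (simp only: lookup_zero)
    then show "of_nat n = (0 :: 'b)"
      by (simp add: lookup_of_nat)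
  next
    assume "of_nat n = (0 :: 'b)"
    then have "Poly_Mapping.single 0 (of_nat n) = (0 :: 'a \<Rightarrow>\<^sub>0 'b)"
      by (simp only: single_zero)
    then show "of_nat n = (0 :: 'a \<Rightarrow>\<^sub>0 'b)"
      by (simp only: single_of_nat)
  qed
  show "of_nat CHAR('b) = (0 :: 'a \<Rightarrow>\<^sub>0 'b)"
    unfolding * by (rule of_nat_CHAR)
  show "CHAR('b) dvd n" if "of_nat n = (0 :: 'a \<Rightarrow>\<^sub>0 'b)" for n
    using that unfolding * of_nat_eq_0_iff_char_dvd .
qed

text \<open>Additivity of the Frobenius power is applied to the sum of \<open>x - y\<close> and
  \<open>y\<close>, which avoids any discussion of the sign of \<open>(-1) ^ m\<close>.\<close>

lemma diff_power_CHAR_power: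
  fixes x y :: "'a::comm_ring_1"
  assumes "prime CHAR('a)" "m = CHAR('a) ^ k"
  shows "(x - y) ^ m = x ^ m - y ^ m"
  using freshmans_dream'[OF assms, of "x - y" y] by (simp add: eq_diff_eq)

text \<open>The content of \<open>partial_character\<close> without monoid records. Nothing is said
  about \<open>\<rho>\<close> outside \<open>L\<close>.\<close>

locale lattice_character = int_lattice L for L :: "(int ^ 'm) set" +
  fixes \<rho> :: "int ^ 'm \<Rightarrow> 'k::field"
  assumes char_add: "\<And>x y. x \<in> L \<Longrightarrow> y \<in> L \<Longrightarrow> \<rho> (x + y) = \<rho> x * \<rho> y"
    and char_nonzero: "\<And>x. x \<in> L \<Longrightarrow> \<rho> x \<noteq> 0"
begin

lemma char_0: "\<rho> 0 = 1"
  using char_add[of 0 0] char_nonzero[of 0] zero_closed by simp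

lemma char_uminus: "x \<in> L \<Longrightarrow> \<rho> (- x) = inverse (\<rho> x)"
  using char_add[of x "- x"] char_nonzero[of x] uminus_closed[of x]
  by (simp add: char_0 inverse_unique)

lemma char_scale: "x \<in> L \<Longrightarrow> \<rho> (int n *s x) = \<rho> x ^ n"
  by (induction n) (simp_all add: char_0 vector_sadd_rdistrib char_add nat_scale_closed)

lemma binomial_of_uminus:
  assumes "v \<in> L"
  shows "binomial_of \<rho> (- v) = - mconst (inverse (\<rho> v)) * binomial_of \<rho> v"
  using char_nonzero[OF assms]
  by (simp add: binomial_of_def pos_part_uminus neg_part_uminus char_uminus[OF assms]
      right_diff_distrib mconst_mult mconst_1 flip: mult.assoc)

text \<open>The monomial factor restores what cancels in \<open>v + w\<close>: it turns the two
  parts of \<open>v + w\<close> into the sums of the positive and of the negative parts. The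
  right-hand side then telescopes.\<close>

lemma binomial_of_add:
  assumes "v \<in> L" "w \<in> L"
  shows "monomial_of (pos_part v + pos_part w - pos_part (v + w)) * binomial_of \<rho> (v + w) =
    monomial_of (pos_part w) * binomial_of \<rho> v +
    mconst (\<rho> v) * monomial_of (neg_part v) * binomial_of \<rho> w"
proof -
  let ?r = "pos_part v + pos_part w - pos_part (v + w)"
  have r: "0 \<le> ?r $ i" for i
    by (simp add: pos_part_def)
  have "monomial_of ?r * monomial_of (pos_part (v + w)) = (monomial_of (pos_part v + pos_part w) :: ('m, 'k) mpoly)"
    using monomial_of_add[of ?r "pos_part (v + w)", where 'b = 'k] r pos_part_nonneg[of "v + w"]
    by (simp only: diff_add_cancel simp_thms)
  moreover have "?r + neg_part (v + w) = neg_part v + neg_part w"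
    using pos_part_diff_neg_part[of v] pos_part_diff_neg_part[of w] pos_part_diff_neg_part[of "v + w"]
    by (simp add: algebra_simps)
  then have "monomial_of ?r * monomial_of (neg_part (v + w)) = (monomial_of (neg_part v + neg_part w) :: ('m, 'k) mpoly)"
    using monomial_of_add[of ?r "neg_part (v + w)", where 'b = 'k] r neg_part_nonneg[of "v + w"]
    by (simp only: simp_thms)
  ultimately show ?thesis
    by (simp add: binomial_of_def char_add[OF assms] monomial_of_add pos_part_nonneg neg_part_nonneg
        algebra_simps flip: mconst_mult)
qed

lemma binomial_of_scale_CHAR_power:
  assumes "v \<in> L" "prime CHAR('k)" "m = CHAR('k) ^ k"
  shows "binomial_of \<rho> (int m *s v) = binomial_of \<rho> v ^ m"
proof -
  have parts: "pos_part (int m *s v) = int m *s pos_part v" "neg_part (int m *s v) = int m *s neg_part v"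
    by (simp_all add: pos_part_def neg_part_def vec_eq_iff max_mult_distrib_left flip: mult_minus_right)
  have "binomial_of \<rho> v ^ m = monomial_of (pos_part v) ^ m - (mconst (\<rho> v) * monomial_of (neg_part v)) ^ m"
    unfolding binomial_of_def
    by (rule diff_power_CHAR_power[where k = k]) (simp_all add: CHAR_poly_mapping assms)
  then show ?thesis
    by (simp add: binomial_of_def parts char_scale[OF assms(1)] monomial_of_scale pos_part_nonneg
        neg_part_nonneg power_mult_distrib mconst_power)
qed

end

subsection \<open>Ideals and radicals\<close>

interpretation self_module: module "(*) :: 'a::comm_ring_1 \<Rightarrow> 'a \<Rightarrow> 'a"
  by unfold_locales (simp_all add: algebra_simps)

text \<open>As a simplification rule it would undo \<open>mult.assoc\<close>.\<close>

declare self_module.scale_scale [simp del]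

definition prime_ideal :: "'a::comm_ring_1 set \<Rightarrow> bool" where
  "prime_ideal P \<longleftrightarrow> self_module.subspace P \<and> 1 \<notin> P \<and> (\<forall>a b. a * b \<in> P \<longrightarrow> a \<in> P \<or> b \<in> P)"

lemma prime_ideal_power: "prime_ideal P \<Longrightarrow> a ^ n \<in> P \<Longrightarrow> a \<in> P"
  by (induction n) (auto simp: prime_ideal_def)

lemma ideal_gen_superset: "S \<subseteq> ideal_gen S"
  by (simp add: ideal_gen_def self_module.span_superset)

lemma subset_ideal_radical: "I \<subseteq> ideal_radical I"
proof
  fix x assume "x \<in> I"
  then have "x ^ 1 \<in> I" by simp
  then show "x \<in> ideal_radical I"
    unfolding ideal_radical_def by (intro CollectI exI[of _ 1]) simp
qed

text \<open>By Zorn's lemma there is an ideal maximal among those that contain \<open>S\<close> and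
  no power of \<open>f\<close>; maximality makes it prime.\<close>

lemma ex_prime_ideal_avoiding:
  assumes "f \<notin> ideal_radical (ideal_gen S)"
  obtains P where "prime_ideal P" "S \<subseteq> P" "f \<notin> P"
proof -
  define A where "A = {I. self_module.subspace I \<and> S \<subseteq> I \<and> (\<forall>n. f ^ n \<notin> I)}"
  have A_I: "I \<in> A" if "self_module.subspace I" "S \<subseteq> I" "\<And>n. f ^ n \<notin> I" for I
    unfolding A_def using that by blast
  have A_D: "self_module.subspace I" "S \<subseteq> I" "f ^ n \<notin> I" if "I \<in> A" for I n
    using that unfolding A_def by blast+
  \<comment> \<open>The radical only speaks of positive exponents; one more factor \<open>f\<close>
    covers the exponent 0 as well.\<close>
  have "f ^ n \<notin> ideal_gen S" for n
  proof
    assume "f ^ n \<in> ideal_gen S"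
    then have "f * f ^ n \<in> ideal_gen S"
      unfolding ideal_gen_def by (rule self_module.span_scale)
    then have "f ^ Suc n \<in> ideal_gen S"
      by simp
    then show False
      using assms unfolding ideal_radical_def by blast
  qed
  then have "ideal_gen S \<in> A"
    by (intro A_I ideal_gen_superset) (simp add: ideal_gen_def)
  then have "A \<noteq> {}"
    by blast
  then have "\<exists>P\<in>A. \<forall>I\<in>A. P \<subseteq> I \<longrightarrow> I = P"
  proof (rule subset_Zorn_nonempty)
    fix C assume "C \<noteq> {}" "subset.chain A C"
    then have sub: "\<And>X. X \<in> C \<Longrightarrow> X \<in> A" and chain: "\<And>X Y. X \<in> C \<Longrightarrow> Y \<in> C \<Longrightarrow> X \<subseteq> Y \<or> Y \<subseteq> X"
      by (auto simp: subset_chain_def)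
    obtain I where I: "I \<in> C"
      using \<open>C \<noteq> {}\<close> by blast
    show "\<Union>C \<in> A"
    proof (rule A_I)
      show "self_module.subspace (\<Union>C)"
      proof (rule self_module.subspaceI)
        show "0 \<in> \<Union>C"
          using self_module.subspace_0[OF A_D(1)[OF sub[OF I]]] I by blast
        show "x + y \<in> \<Union>C" if xy: "x \<in> \<Union>C" "y \<in> \<Union>C" for x y
        proof -
          obtain X Y where XY: "x \<in> X" "X \<in> C" "y \<in> Y" "Y \<in> C"
            using xy by blast
          then obtain Z where Z: "x \<in> Z" "y \<in> Z" "Z \<in> C"
            using chain[OF XY(2,4)] by blast
          then show ?thesis
            using self_module.subspace_add[OF A_D(1)[OF sub[OF Z(3)]] Z(1,2)] by blast
        qed
        show "c * x \<in> \<Union>C" if x: "x \<in> \<Union>C" for c x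
        proof -
          obtain X where X: "x \<in> X" "X \<in> C"
            using x by blast
          then show ?thesis
            using self_module.subspace_scale[OF A_D(1)[OF sub[OF X(2)]] X(1)] by blast
        qed
      qed
      show "S \<subseteq> \<Union>C"
        using A_D(2)[OF sub[OF I]] I by blast
      show "f ^ n \<notin> \<Union>C" for n
        using A_D(3)[OF sub] by blast
    qed
  qed
  then obtain P where P: "P \<in> A" and max: "\<And>I. I \<in> A \<Longrightarrow> P \<subseteq> I \<Longrightarrow> I = P"
    by blast
  have subP: "self_module.subspace P"
    using P by (rule A_D(1))
  \<comment> \<open>By maximality, adjoining \<open>a\<close> to \<open>P\<close> yields an ideal
    that contains a power of \<open>f\<close>.\<close>
  have step: "\<exists>n p r. p \<in> P \<and> f ^ n = p + r * a" if "a \<notin> P" for a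
  proof (rule ccontr)
    assume neg: "\<not> ?thesis"
    let ?I = "self_module.span (insert a P)"
    have "f ^ n \<notin> ?I" for n
    proof
      assume "f ^ n \<in> ?I"
      then obtain r where "f ^ n - r * a \<in> P"
        using self_module.span_breakdown_eq[of _ a P] self_module.span_eq_iff[THEN iffD2, OF subP] by blast
      moreover have "f ^ n = (f ^ n - r * a) + r * a"
        by simp
      ultimately show False
        using neg by blast
    qed
    moreover have sup: "insert a P \<subseteq> ?I"
      by (rule self_module.span_superset)
    ultimately have "?I \<in> A"
      using A_D(2)[OF P] by (intro A_I self_module.subspace_span) blast+
    then have "?I = P"
      using sup by (intro max) blast+
    then show False
      using that sup by blast
  qed
  have "prime_ideal P"
    unfolding prime_ideal_def
  proof (intro conjI allI impI)
    show "1 \<notin> P"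
      using A_D(3)[OF P, of 0] by simp
    show "a \<in> P \<or> b \<in> P" if ab: "a * b \<in> P" for a b
    proof (rule ccontr)
      assume neg: "\<not> ?thesis"
      obtain n p r where a: "p \<in> P" "f ^ n = p + r * a"
        using step[of a] neg by blast
      obtain m q s where b: "q \<in> P" "f ^ m = q + s * b"
        using step[of b] neg by blast
      note scale = self_module.subspace_scale[OF subP]
      \<comment> \<open>In the product of the two representations every term has a factor in
        \<open>P\<close>, the last one being \<open>a * b\<close>.\<close>
      have "f ^ (n + m) = (q + s * b) * p + r * a * q + r * s * (a * b)"
        unfolding power_add a(2) b(2) by (simp add: algebra_simps)
      also have "\<dots> \<in> P"
        by (rule self_module.subspace_add[OF subP self_module.subspace_add[OF subP scale[OF a(1)] scale[OF b(1)]] scale[OF ab]])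
      finally show False
        using A_D(3)[OF P] by blast
    qed
  qed (fact subP)
  moreover have "S \<subseteq> P"
    using P by (rule A_D(2))
  moreover have "f \<notin> P"
    using A_D(3)[OF P, of 1] by simp
  ultimately show thesis
    using that by blast
qed

lemma ideal_gen_subset_prime_ideal: "prime_ideal P \<Longrightarrow> S \<subseteq> P \<Longrightarrow> ideal_gen S \<subseteq> P"
  unfolding ideal_gen_def by (rule self_module.span_minimal) (simp_all add: prime_ideal_def)

text \<open>The radical is the intersection of the prime ideals above the ideal, so inclusions of
  radicals are tested prime by prime on generators.\<close>

lemma ideal_radical_subset_iff:
  "ideal_radical (ideal_gen S) \<subseteq> ideal_radical (ideal_gen T) \<longleftrightarrow> (\<forall>P. prime_ideal P \<and> T \<subseteq> P \<longrightarrow> S \<subseteq> P)"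
proof (intro iffI allI impI subsetI)
  fix P x
  assume sub: "ideal_radical (ideal_gen S) \<subseteq> ideal_radical (ideal_gen T)"
    and "prime_ideal P \<and> T \<subseteq> P" and "x \<in> S"
  then have "prime_ideal P" "T \<subseteq> P" by simp_all
  have "x \<in> ideal_radical (ideal_gen S)"
    using \<open>x \<in> S\<close> ideal_gen_superset[of S] subset_ideal_radical[of "ideal_gen S"] by blast
  then have "x \<in> ideal_radical (ideal_gen T)"
    using sub by blast
  then obtain n where "x ^ n \<in> ideal_gen T"
    by (auto simp: ideal_radical_def)
  then have "x ^ n \<in> P"
    using ideal_gen_subset_prime_ideal[OF \<open>prime_ideal P\<close> \<open>T \<subseteq> P\<close>] by blast
  then show "x \<in> P"
    by (rule prime_ideal_power[OF \<open>prime_ideal P\<close>])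
next
  fix f
  assume *: "\<forall>P. prime_ideal P \<and> T \<subseteq> P \<longrightarrow> S \<subseteq> P" and "f \<in> ideal_radical (ideal_gen S)"
  then obtain n where n: "f ^ n \<in> ideal_gen S"
    by (auto simp: ideal_radical_def)
  show "f \<in> ideal_radical (ideal_gen T)"
  proof (rule ccontr)
    assume "f \<notin> ideal_radical (ideal_gen T)"
    then obtain P where P: "prime_ideal P" "T \<subseteq> P" "f \<notin> P"
      by (rule ex_prime_ideal_avoiding)
    then have "S \<subseteq> P"
      using * by blast
    then have "f ^ n \<in> P"
      using n ideal_gen_subset_prime_ideal[OF P(1)] by blast
    then show False
      using P(3) prime_ideal_power[OF P(1)] by blast
  qed
qed

text \<open>A product lies in a prime ideal exactly when a factor does, and the factors other than 1
  are the variables in the support.\<close>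

lemma monomial_of_in_prime_ideal_iff:
  fixes P :: "('m::finite, 'k::field) mpoly set"
  assumes P: "prime_ideal P" and v: "\<And>i. 0 \<le> v $ i"
  shows "monomial_of v \<in> P \<longleftrightarrow> v \<notin> coord_lattice {i. mvar i \<notin> P}"
proof -
  have sub: "self_module.subspace P" and one: "1 \<notin> P" and prime: "\<And>a b. a * b \<in> P \<Longrightarrow> a \<in> P \<or> b \<in> P"
    using P by (auto simp: prime_ideal_def)
  have prod: "prod f I \<in> P \<longleftrightarrow> (\<exists>i\<in>I. f i \<in> P)" if "finite I" for f and I :: "'m set"
    using that
  proof (induction I)
    case (insert i I)
    have "f i * prod f I \<in> P \<longleftrightarrow> f i \<in> P \<or> prod f I \<in> P"
      using prime self_module.subspace_scale[OF sub] by (metis mult.commute)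
    then show ?case using insert by simp
  qed (simp add: one)
  have pow: "mvar i ^ n \<in> P \<longleftrightarrow> mvar i \<in> P \<and> 0 < n" for i :: 'm and n
  proof
    assume "mvar i ^ n \<in> P"
    then show "mvar i \<in> P \<and> 0 < n"
      using prime_ideal_power[OF P, of "mvar i" n] one by (cases n) (auto simp del: power_Suc)
  next
    assume "mvar i \<in> P \<and> 0 < n"
    then obtain k where "mvar i \<in> P" "n = Suc k"
      using gr0_implies_Suc by blast
    then show "mvar i ^ n \<in> P"
      using self_module.subspace_scale[OF sub, of "mvar i" "mvar i ^ k"]
      by (simp only: power_Suc2)
  qed
  have pos: "0 < nat (v $ i) \<longleftrightarrow> v $ i \<noteq> 0" for i
    using v[of i] by linarith
  have "monomial_of v \<in> P \<longleftrightarrow> (\<exists>i. mvar i \<in> P \<and> v $ i \<noteq> 0)"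
    unfolding monomial_of_def by (simp only: prod[OF finite] pow pos bex_UNIV)
  then show ?thesis
    by (auto simp: coord_lattice_def supp_def)
qed

subsection \<open>Linear functionals on the polynomial ring\<close>

text \<open>The linear form with value \<open>\<kappa> v\<close> at the monomial with exponent
  \<open>v\<close>. Indexing by integer vectors allows \<open>\<kappa>\<close> to be given by cosets
  of a lattice.\<close>

definition functional :: "(int ^ 'm \<Rightarrow> 'k) \<Rightarrow> ('m, 'k::field) mpoly \<Rightarrow> 'k" where
  "functional \<kappa> f = (\<Sum>e\<in>Poly_Mapping.keys f. Poly_Mapping.lookup f e * \<kappa> (vector_of e))"

lemma functional_0 [simp]: "functional \<kappa> 0 = 0"
  by (simp add: functional_def)

lemma functional_add: "functional \<kappa> (f + g) = functional \<kappa> f + functional \<kappa> g"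
  unfolding functional_def
  using setsum_keys_plus_distrib[of "\<lambda>e c. c * \<kappa> (vector_of e)" f g] by (simp add: algebra_simps)

lemma functional_diff: "functional \<kappa> (f - g) = functional \<kappa> f - functional \<kappa> g"
  using functional_add[of \<kappa> "f - g" g] by (simp add: eq_diff_eq)

lemma functional_single: "functional \<kappa> (Poly_Mapping.single e c) = c * \<kappa> (vector_of e)"
  by (simp add: functional_def)

lemma functional_1: "functional \<kappa> 1 = \<kappa> 0"
  by (simp add: functional_single vector_of_def flip: single_one) (simp add: zero_vec_def)

lemma poly_mapping_single_add_induct [case_names zero single_add]:
  assumes "P 0" "\<And>e c f. P f \<Longrightarrow> P (Poly_Mapping.single e c + f)"
  shows "P f"
proof (induction f rule: update_induct)
  case (update f a b)
  have "Poly_Mapping.update a b f = Poly_Mapping.single a b + f"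
    using update(1) by (intro poly_mapping_eqI)
      (auto simp: lookup_update lookup_add lookup_single when_def in_keys_iff)
  then show ?case
    using update assms(2) by simp
qed (fact assms(1))

lemma functional_single_mult:
  "functional \<kappa> (Poly_Mapping.single e c * f) = c * functional (\<lambda>v. \<kappa> (vector_of e + v)) f"
  by (induction f rule: poly_mapping_single_add_induct)
    (simp_all add: distrib_left mult_single functional_add functional_single vector_of_add)

lemma functional_mconst_mult: "functional \<kappa> (mconst c * f) = c * functional \<kappa> f"
  by (simp add: mconst_def functional_single_mult vector_of_def zero_vec_def[symmetric])

lemma functional_monomial_mult:
  "(\<And>i. 0 \<le> v $ i) \<Longrightarrow> functional \<kappa> (monomial_of v * f) = functional (\<lambda>w. \<kappa> (v + w)) f"
  by (simp add: monomial_of_eq_single functional_single_mult vector_of_exponent_of)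

lemma functional_binomial_mult:
  "functional \<kappa> (binomial_of \<rho> v * f) =
    functional (\<lambda>w. \<kappa> (pos_part v + w)) f - \<rho> v * functional (\<lambda>w. \<kappa> (neg_part v + w)) f"
  by (simp add: binomial_of_def left_diff_distrib functional_diff functional_mconst_mult
      functional_monomial_mult pos_part_nonneg neg_part_nonneg mult.assoc)

text \<open>Only non-negative vectors occur as exponents. For them, membership of a sum in
  \<open>coord_lattice E\<close> splits into membership of the summands.\<close>

lemma functional_cong:
  "(\<And>v. (\<And>i. 0 \<le> v $ i) \<Longrightarrow> \<kappa> v = \<kappa>' v) \<Longrightarrow> functional \<kappa> f = functional \<kappa>' f"
  by (simp add: functional_def vector_of_nonneg)

lemma functional_scale: "functional (\<lambda>v. c * \<kappa> v) f = c * functional \<kappa> f"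
  by (simp add: functional_def sum_distrib_left ac_simps)

lemma functional_zero_function: "functional (\<lambda>_. 0) f = 0"
  by (simp add: functional_def)

text \<open>The hypothesis covers all multiples of generators, because coefficients in the span are
  arbitrary polynomials.\<close>

lemma functional_ideal_gen:
  assumes "\<And>b f. b \<in> S \<Longrightarrow> functional \<kappa> (b * f) = 0" "g \<in> ideal_gen S"
  shows "functional \<kappa> g = 0"
  using assms(2) unfolding ideal_gen_def
proof (induction rule: self_module.span_induct_alt)
  case (step c x y)
  then show ?case
    using assms(1)[of x c] by (simp add: functional_add mult.commute)
qed simp

section \<open>Functionals supported on cosets of a sublattice\<close>

context lattice_character
begin

text \<open>The functional given by \<open>coset_char E M w\<close> factors through the quotient by the variables
  outside \<open>E\<close> and there reads off the component in the coset \<open>w + M\<close>, twisted by \<open>\<rho>\<close>.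
  It replaces a point with support \<open>E\<close>, for which one would have to extend \<open>\<rho>\<close> to \<open>\<int>\<^sup>E\<close>
  over an algebraically closed field.\<close>

definition coset_char :: "'m set \<Rightarrow> (int ^ 'm) set \<Rightarrow> int ^ 'm \<Rightarrow> int ^ 'm \<Rightarrow> 'k" where
  "coset_char E M w v = (if v \<in> coord_lattice E \<and> v - w \<in> M then \<rho> (v - w) else 0)"

text \<open>Multiplication by the monomial of \<open>p\<close> either brings in a variable outside
  \<open>E\<close>, which the functional kills, or moves the coset by \<open>p\<close>.\<close>

lemma functional_coset_char_shift:
  assumes p: "\<And>i. 0 \<le> p $ i"
  shows "functional (\<lambda>v. coset_char E M w (p + v)) f =
    (if p \<in> coord_lattice E then functional (coset_char E M (w - p)) f else 0)"
proof (cases "p \<in> coord_lattice E")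
  case True
  then have "coset_char E M w (p + v) = coset_char E M (w - p) v" if "\<And>i. 0 \<le> v $ i" for v
    using that by (simp add: coset_char_def coord_lattice_add_iff p algebra_simps)
  then show ?thesis
    using True by (auto intro: functional_cong)
next
  case False
  then have "coset_char E M w (p + v) = 0" if "\<And>i. 0 \<le> v $ i" for v
    using that by (simp add: coset_char_def coord_lattice_add_iff p)
  then have "functional (\<lambda>v. coset_char E M w (p + v)) f = functional (\<lambda>_. 0) f"
    by (rule functional_cong)
  then show ?thesis
    using False by (simp add: functional_zero_function)
qed

lemma functional_coset_char_binomial_mult:
  "functional (coset_char E M w) (binomial_of \<rho> v * f) =
    (if pos_part v \<in> coord_lattice E then functional (coset_char E M (w - pos_part v)) f else 0) -
    \<rho> v * (if neg_part v \<in> coord_lattice E then functional (coset_char E M (w - neg_part v)) f else 0)"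
  unfolding functional_binomial_mult
  by (simp only: functional_coset_char_shift pos_part_nonneg neg_part_nonneg)

text \<open>Both representatives define the same coset; changing the base point by \<open>x\<close>
  only multiplies the twist by \<open>\<rho> x\<close>.\<close>

lemma functional_coset_char_diff:
  assumes M: "int_lattice M" "M \<subseteq> L" and x: "x \<in> M"
  shows "functional (coset_char E M (w - x)) f = \<rho> x * functional (coset_char E M w) f"
proof -
  interpret M: int_lattice M by fact
  have "coset_char E M (w - x) v = \<rho> x * coset_char E M w v" for v
  proof -
    have "v - w \<in> M \<longleftrightarrow> v - (w - x) \<in> M"
      using M.add_closed[OF _ x, of "v - w"] M.diff_closed[OF _ x, of "v - (w - x)"]
      by (auto simp: algebra_simps)
    moreover have "\<rho> (v - (w - x)) = \<rho> x * \<rho> (v - w)" if "v - w \<in> M"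
      using char_add[of "v - w" x] M(2) x that by (auto simp: algebra_simps)
    ultimately show ?thesis
      by (simp add: coset_char_def)
  qed
  then have "coset_char E M (w - x) = (\<lambda>v. \<rho> x * coset_char E M w v)"
    by (rule ext)
  then show ?thesis
    by (simp add: functional_scale)
qed

text \<open>For balanced \<open>v\<close> either both monomials of its binomial are killed, or
  \<open>v\<close> lies in \<open>M\<close>. In the second case the two shifted base points differ
  by \<open>v\<close>, and the factor \<open>\<rho> v\<close> makes the terms cancel.\<close>

lemma functional_coset_char_vanishes:
  assumes M: "int_lattice M" "M \<subseteq> L"
    and U: "\<And>v. v \<in> U \<Longrightarrow> balanced E v" "U \<inter> coord_lattice E \<subseteq> M"
    and g: "g \<in> ideal_gen (binomial_of \<rho> ` U)"
  shows "functional (coset_char E M w) g = 0"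
proof (rule functional_ideal_gen[OF _ g])
  fix b f assume "b \<in> binomial_of \<rho> ` U"
  then obtain v where v: "v \<in> U" "b = binomial_of \<rho> v"
    by blast
  show "functional (coset_char E M w) (b * f) = 0"
  proof (cases "pos_part v \<in> coord_lattice E")
    case True
    then have "v \<in> M" and neg: "neg_part v \<in> coord_lattice E"
      using U v coord_lattice_parts_iff[of v E] by (auto simp: balanced_def)
    have "w - pos_part v = w - neg_part v - v"
      using pos_part_diff_neg_part[of v] by (simp add: algebra_simps)
    then show ?thesis
      using functional_coset_char_diff[OF M \<open>v \<in> M\<close>, of E "w - neg_part v" f] True neg
      unfolding v(2) functional_coset_char_binomial_mult by (simp only: if_True diff_self)
  next
    case False
    then show ?thesis
      using U(1)[OF v(1)] by (simp add: v balanced_def functional_coset_char_binomial_mult)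
  qed
qed

lemma coset_char_0_0: "0 \<in> M \<Longrightarrow> coset_char E M 0 0 = 1"
  by (simp add: coset_char_def char_0 coord_lattice_def supp_def)

text \<open>If \<open>v\<close> were not balanced, exactly one monomial of its binomial would
  survive on \<open>E\<close>. Multiplication by the binomial would then act as a shift of the base
  point with a non-zero factor, so no power could be annihilated.\<close>

lemma balanced_if_in_radical:
  assumes U: "U \<subseteq> L" "\<And>x. x \<in> U \<Longrightarrow> balanced E x" and v: "v \<in> L"
    and rad: "binomial_of \<rho> v \<in> ideal_radical (ideal_gen (binomial_of \<rho> ` U))"
  shows "balanced E v"
proof (rule ccontr)
  assume "\<not> balanced E v"
  then consider "pos_part v \<in> coord_lattice E" "neg_part v \<notin> coord_lattice E"
    | "neg_part v \<in> coord_lattice E" "pos_part v \<notin> coord_lattice E"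
    by (auto simp: balanced_def)
  then obtain p c where c: "c \<noteq> 0" and
    step: "\<And>w f. functional (coset_char E L w) (binomial_of \<rho> v * f) = c * functional (coset_char E L (w - p)) f"
  proof cases
    case 1
    then show ?thesis
      using that[of 1 "pos_part v"] by (simp add: functional_coset_char_binomial_mult)
  next
    case 2
    then show ?thesis
      using that[of "- \<rho> v" "neg_part v"] char_nonzero[OF v]
      by (simp add: functional_coset_char_binomial_mult)
  qed
  have pow: "functional (coset_char E L w) (binomial_of \<rho> v ^ n) = c ^ n * coset_char E L (w - int n *s p) 0" for w n
    by (induction n arbitrary: w) (simp_all add: functional_1 step vector_sadd_rdistrib algebra_simps)
  obtain n where "binomial_of \<rho> v ^ n \<in> ideal_gen (binomial_of \<rho> ` U)"
    using rad by (auto simp: ideal_radical_def)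
  \<comment> \<open>The base point is chosen so that \<open>n\<close> shifts by \<open>p\<close> end
    at 0, whose coset contains the exponent of the monomial 1.\<close>
  then have "functional (coset_char E L (int n *s p)) (binomial_of \<rho> v ^ n) = 0"
    using U by (intro functional_coset_char_vanishes) (auto simp: int_lattice_axioms)
  then show False
    unfolding pow using c by (simp add: coset_char_0_0 zero_closed)
qed

end

text \<open>In characteristic zero \<open>(1 - y)\<^sup>n\<close> does not vanish in the group algebra of a non-trivial
  cyclic group: if \<open>(1 - y)\<^sup>n = 0\<close> with \<open>n\<close> at least 2, then \<open>(1 - y)\<^sup>n\<^sup>-\<^sup>1\<close> is invariant under \<open>y\<close>,
  but its coefficients sum to 0. Here \<open>t n j\<close> is a coefficient of \<open>(1 - y)\<^sup>n\<close>.\<close>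

lemma iterated_differences_vanish:
  fixes t :: "nat \<Rightarrow> nat \<Rightarrow> 'k::field"
  assumes char: "CHAR('k) = 0"
    and t_0: "\<And>j. t 0 j = (if j \<in> D then 1 else 0)"
    and t_Suc: "\<And>n j. t (Suc n) j = t n j - t n (Suc j)"
    and D: "0 \<in> D" "\<And>d j. d \<in> D \<Longrightarrow> d + j \<in> D \<longleftrightarrow> j \<in> D"
    and vanish: "\<And>j. t n j = 0"
  shows "1 \<in> D"
\<comment> \<open>This is the case of infinite order; otherwise \<open>D\<close> contains a positive
  period \<open>d\<close>.\<close>
proof (cases "D = {0}")
  case True
  have "t n 0 = 1 \<and> (\<forall>j>0. t n j = 0)"
    by (induction n) (simp_all add: t_0 t_Suc True)
  then show ?thesis
    using vanish by simp
next
  case False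
  then obtain d where d: "d \<in> D" "0 < d"
    using D(1) by blast
  have periodic: "t n (d + j) = t n j" for n j
    by (induction n arbitrary: j) (simp_all add: t_0 t_Suc D(2)[OF d(1)] flip: add_Suc_right)
  have vanish_step: "t (Suc n) j = 0" if "\<And>j. t (Suc (Suc n)) j = 0" for n j
  proof -
    have "t (Suc n) (Suc j) = t (Suc n) j" for j
      using that[of j] t_Suc[of "Suc n" j] by (metis right_minus_eq)
    then have const: "t (Suc n) j = t (Suc n) 0" for j
      by (induction j) metis+
    \<comment> \<open>A constant difference summed over a full period telescopes to 0, and
      \<open>d\<close> is invertible in characteristic zero.\<close>
    have "of_nat d * t (Suc n) 0 = (\<Sum>j<d. t (Suc n) 0)"
      by simp
    also have "\<dots> = (\<Sum>j<d. t (Suc n) j)"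
      by (intro sum.cong refl const[symmetric])
    also have "\<dots> = t n 0 - t n d"
      unfolding t_Suc by (rule sum_lessThan_telescope')
    also have "\<dots> = 0"
      using periodic[of n 0] by (simp only: add_0_right diff_self)
    finally have "t (Suc n) 0 = 0"
      using char d(2) CHAR_eq0_iff[where 'a = 'k] by auto
    then show ?thesis
      by (rule trans[OF const])
  qed
  have descend: "t 1 0 = 0" if "\<And>j. t (Suc n) j = 0" for n
    using that
  proof (induction n)
    case 0
    show ?case
      unfolding One_nat_def by (rule 0)
  next
    case (Suc n)
    show ?case
      by (rule Suc.IH, rule vanish_step, rule Suc.prems)
  qed
  show ?thesis
  proof (cases n)
    case 0
    then show ?thesis using vanish[of 0] D(1) by (simp add: t_0)
  next
    case (Suc m)
    have "t 1 0 = 0"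
      by (rule descend[of m]) (use vanish Suc in simp)
    then show ?thesis
      \<comment> \<open>From \<open>t 1 0 = 0\<close> the entries of row 0 at 0 and 1 agree; the
        former is 1 because 0 is in \<open>D\<close>.\<close>
      using D(1) t_Suc[of 0 0] by (auto simp: t_0 split: if_splits)
  qed
qed

section \<open>Necessity of the lattice conditions\<close>

context lattice_character
begin

text \<open>On exponents in \<open>E\<close>, multiplication by the binomial of \<open>v\<close>
  becomes, up to a shift, one minus translation by the class of \<open>v\<close> modulo
  \<open>M\<close>. By \<open>iterated_differences_vanish\<close> it can be nilpotent only if this
  class is trivial.\<close>

lemma sublattice_if_in_radical_char_0:
  assumes char: "CHAR('k) = 0" and M: "int_lattice M" "M \<subseteq> L"
    and U: "\<And>x. x \<in> U \<Longrightarrow> balanced E x" "U \<inter> coord_lattice E \<subseteq> M"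
    and v: "v \<in> L" "v \<in> coord_lattice E"
    and rad: "binomial_of \<rho> v \<in> ideal_radical (ideal_gen (binomial_of \<rho> ` U))"
  shows "v \<in> M"
proof -
  interpret M: int_lattice M by fact
  obtain n where n: "binomial_of \<rho> v ^ n \<in> ideal_gen (binomial_of \<rho> ` U)"
    using rad by (auto simp: ideal_radical_def)
  \<comment> \<open>The multiple of \<open>pos_part v\<close> compensates the shift made by each
    factor, and \<open>\<rho> v ^ j\<close> absorbs the twist, so that the recursion is a plain
    difference.\<close>
  define t where "t k j = \<rho> v ^ j *
    functional (coset_char E M (int k *s pos_part v + int j *s v)) (binomial_of \<rho> v ^ k)" for k j
  let ?D = "{j. int j *s v \<in> M}"
  have "1 \<in> ?D"
  proof (rule iterated_differences_vanish[OF char, of t])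
    show "t 0 j = (if j \<in> ?D then 1 else 0)" for j
    proof -
      have "- (int j *s v) \<in> M \<longleftrightarrow> int j *s v \<in> M"
        using M.uminus_closed[of "int j *s v"] M.uminus_closed[of "- (int j *s v)"] by auto
      moreover have "\<rho> v ^ j * \<rho> (- (int j *s v)) = 1"
        using char_nonzero[OF v(1)] by (simp add: char_uminus nat_scale_closed v char_scale)
      ultimately show ?thesis
        by (simp add: t_def functional_1 coset_char_def coord_lattice_def supp_def)
    qed
    show "t (Suc k) j = t k j - t k (Suc j)" for k j
    proof -
      have "int (Suc k) *s pos_part v + int j *s v - pos_part v = int k *s pos_part v + int j *s v"
        by (simp add: vector_sadd_rdistrib)
      moreover have "int (Suc k) *s pos_part v + int j *s v - neg_part v =
          int k *s pos_part v + int (Suc j) *s v"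
        using pos_part_diff_neg_part[of v] by (simp add: vector_sadd_rdistrib algebra_simps)
      ultimately show ?thesis
        using v(2) coord_lattice_parts_iff[of v E] unfolding t_def power_Suc functional_coset_char_binomial_mult
        by (simp only: if_True simp_thms) (simp add: algebra_simps del: of_nat_Suc)
    qed
    show "0 \<in> ?D"
      by (simp add: M.zero_closed)
    show "d + j \<in> ?D \<longleftrightarrow> j \<in> ?D" if "d \<in> ?D" for d j
      using that M.add_closed[of "int d *s v" "int j *s v"] M.diff_closed[of "int (d + j) *s v" "int d *s v"]
      by (auto simp: vector_sadd_rdistrib)
    show "t n j = 0" for j
      unfolding t_def using functional_coset_char_vanishes[OF M U n] by simp
  qed
  then show ?thesis by simp
qed

text \<open>A Frobenius power of the binomial of \<open>v\<close> is again a binomial. Once it lies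
  in the ideal, the functional at its positive part detects whether its vector is in
  \<open>M\<close>.\<close>

lemma sublattice_if_in_radical_char_pos:
  assumes char: "CHAR('k) > 0" and M: "int_lattice M" "M \<subseteq> L"
    and U: "\<And>x. x \<in> U \<Longrightarrow> balanced E x" "U \<inter> coord_lattice E \<subseteq> M"
    and v: "v \<in> L" "v \<in> coord_lattice E"
    and rad: "binomial_of \<rho> v \<in> ideal_radical (ideal_gen (binomial_of \<rho> ` U))"
  shows "v \<in> lattice_colon M CHAR('k)"
proof -
  interpret M: int_lattice M by fact
  interpret Z: int_lattice "coord_lattice E" by (rule int_lattice_coord_lattice)
  have p: "prime CHAR('k)"
    using char by (rule prime_CHAR_semidom)
  obtain n where n: "binomial_of \<rho> v ^ n \<in> ideal_gen (binomial_of \<rho> ` U)"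
    using rad by (auto simp: ideal_radical_def)
  \<comment> \<open>This exponent is a power of the characteristic and at least
    \<open>n\<close>.\<close>
  define m where "m = CHAR('k) ^ n"
  have "n \<le> m"
    unfolding m_def using prime_gt_1_nat[OF p] by (intro less_imp_le power_gt_expt) simp
  then have "binomial_of \<rho> v ^ m = binomial_of \<rho> v ^ (m - n) * binomial_of \<rho> v ^ n"
    by (simp flip: power_add)
  also have "\<dots> \<in> ideal_gen (binomial_of \<rho> ` U)"
    using n unfolding ideal_gen_def by (rule self_module.span_scale)
  finally have *: "binomial_of \<rho> (int m *s v) * 1 \<in> ideal_gen (binomial_of \<rho> ` U)"
    by (simp add: binomial_of_scale_CHAR_power[OF v(1) p m_def])
  let ?x = "int m *s v"
  have x: "pos_part ?x \<in> coord_lattice E" "neg_part ?x \<in> coord_lattice E"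
    using Z.scale_closed[OF v(2)] coord_lattice_parts_iff[of ?x E] by auto
  have "?x \<in> M"
  proof (rule ccontr)
    assume "?x \<notin> M"
    then have "- ?x \<notin> M"
      using M.uminus_closed[of "- ?x"] by auto
    \<comment> \<open>The positive monomial is the base point and contributes 1; the negative one
      differs from it by \<open>?x\<close>, outside \<open>M\<close>, and contributes 0.\<close>
    have "functional (coset_char E M (pos_part ?x)) (binomial_of \<rho> ?x * 1) =
        coset_char E M 0 0 - \<rho> ?x * coset_char E M ?x 0"
      unfolding functional_coset_char_binomial_mult functional_1
      by (simp only: x if_True diff_self pos_part_diff_neg_part)
    also have "\<dots> = 1"
      using \<open>- ?x \<notin> M\<close> by (simp add: coset_char_0_0 M.zero_closed coset_char_def[of _ _ ?x])
    finally show False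
      using functional_coset_char_vanishes[OF M U *] by simp
  qed
  then show ?thesis
    by (auto simp: lattice_colon_def m_def intro: exI[of _ n])
qed

section \<open>Prime ideals containing binomials, and the theorem in terms of balanced sets\<close>

text \<open>Closure under sums rests on \<open>binomial_of_add\<close>: the monomial factor there
  involves only variables outside \<open>P\<close>, so primality cancels it.\<close>

lemma int_lattice_binomial_in_prime_ideal:
  assumes P: "prime_ideal P" and E: "E = {i. mvar i \<notin> P}"
  shows "int_lattice {v \<in> L \<inter> coord_lattice E. binomial_of \<rho> v \<in> P}"
proof -
  interpret LE: int_lattice "L \<inter> coord_lattice E"
    by (intro int_lattice_Int int_lattice_axioms int_lattice_coord_lattice)
  have sub: "self_module.subspace P"
    using P by (simp add: prime_ideal_def)
  show ?thesis
  proof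
    have "binomial_of \<rho> 0 = 0"
      by (simp add: binomial_of_def char_0 mconst_1 pos_part_def neg_part_def)
    then show "0 \<in> {v \<in> L \<inter> coord_lattice E. binomial_of \<rho> v \<in> P}"
      using LE.zero_closed self_module.subspace_0[OF sub] by simp
  next
    fix x assume "x \<in> {v \<in> L \<inter> coord_lattice E. binomial_of \<rho> v \<in> P}"
    then show "- x \<in> {v \<in> L \<inter> coord_lattice E. binomial_of \<rho> v \<in> P}"
      using LE.uminus_closed[of x] self_module.subspace_scale[OF sub, of "binomial_of \<rho> x" "- mconst (inverse (\<rho> x))"]
      by (simp add: binomial_of_uminus)
  next
    fix x y
    assume "x \<in> {v \<in> L \<inter> coord_lattice E. binomial_of \<rho> v \<in> P}"
      "y \<in> {v \<in> L \<inter> coord_lattice E. binomial_of \<rho> v \<in> P}"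
    then have x: "x \<in> L" "x \<in> coord_lattice E" "binomial_of \<rho> x \<in> P"
      and y: "y \<in> L" "y \<in> coord_lattice E" "binomial_of \<rho> y \<in> P"
      by auto
    let ?r = "pos_part x + pos_part y - pos_part (x + y)"
    have r: "0 \<le> ?r $ i" for i
      by (simp add: pos_part_def)
    \<comment> \<open>The left side is the sum of the positive parts of \<open>x\<close> and
      \<open>y\<close>; a non-negative summand of a vector supported in \<open>E\<close> is
      supported in \<open>E\<close>.\<close>
    have "?r + pos_part (x + y) \<in> coord_lattice E"
      using x(2) y(2) coord_lattice_parts_iff[of x E] coord_lattice_parts_iff[of y E]
      by (simp add: coord_lattice_add_iff pos_part_nonneg)
    then have "?r \<in> coord_lattice E"
      using coord_lattice_add_iff[OF r pos_part_nonneg] by blast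
    then have "monomial_of ?r \<notin> P"
      using monomial_of_in_prime_ideal_iff[OF P r] E by simp
    moreover have "monomial_of ?r * binomial_of \<rho> (x + y) \<in> P"
      unfolding binomial_of_add[OF x(1) y(1)]
      by (intro self_module.subspace_add self_module.subspace_scale sub x y)
    ultimately have "binomial_of \<rho> (x + y) \<in> P"
      using P by (auto simp: prime_ideal_def)
    moreover have "x + y \<in> L \<inter> coord_lattice E"
      using LE.add_closed x y by blast
    ultimately show "x + y \<in> {v \<in> L \<inter> coord_lattice E. binomial_of \<rho> v \<in> P}"
      by simp
  qed
qed

text \<open>Modulo \<open>P\<close> the two monomials agree up to a unit, so they lie in
  \<open>P\<close> together.\<close>

lemma balanced_if_binomial_in_prime_ideal:
  assumes P: "prime_ideal P" and v: "v \<in> L" "binomial_of \<rho> v \<in> P"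
  shows "balanced {i. mvar i \<notin> P} v"
proof -
  have sub: "self_module.subspace P"
    using P by (simp add: prime_ideal_def)
  let ?x = "monomial_of (pos_part v)" and ?y = "monomial_of (neg_part v)"
  have "?x \<in> P" if "?y \<in> P"
  proof -
    have "?x = binomial_of \<rho> v + mconst (\<rho> v) * ?y"
      by (simp add: binomial_of_def)
    then show ?thesis
      using self_module.subspace_add[OF sub v(2) self_module.subspace_scale[OF sub that]] by metis
  qed
  moreover have "?y \<in> P" if "?x \<in> P"
  proof -
    have "?y = mconst (inverse (\<rho> v)) * (?x - binomial_of \<rho> v)"
      using char_nonzero[OF v(1)] by (simp add: binomial_of_def mconst_mult mconst_1 flip: mult.assoc)
    then show ?thesis
      using self_module.subspace_scale[OF sub self_module.subspace_diff[OF sub that v(2)]] by metis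
  qed
  ultimately show ?thesis
    unfolding balanced_def
    using monomial_of_in_prime_ideal_iff[OF P pos_part_nonneg[of v]]
      monomial_of_in_prime_ideal_iff[OF P neg_part_nonneg[of v]] by blast
qed

text \<open>This is the theorem with index sets of faces replaced by the sets \<open>E\<close> for
  which all of \<open>L\<close> is balanced. Functionals give necessity, prime ideals
  sufficiency.\<close>

lemma radical_lattice_ideal_eq_iff:
  fixes u :: "'i \<Rightarrow> int ^ 'm"
  assumes I: "finite I" and u: "\<And>i. i \<in> I \<Longrightarrow> u i \<in> L"
  defines "M \<equiv> \<lambda>E. sum_lattice u {i\<in>I. u i \<in> coord_lattice E}"
  shows "ideal_radical (lattice_ideal L \<rho>) = ideal_radical (ideal_gen (binomial_of \<rho> ` u ` I)) \<longleftrightarrow>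
    (\<forall>E. \<not> (\<forall>v\<in>L. balanced E v) \<longrightarrow> (\<exists>i\<in>I. \<not> balanced E (u i))) \<and>
    (\<forall>E. (\<forall>v\<in>L. balanced E v) \<longrightarrow>
      (CHAR('k) = 0 \<longrightarrow> L \<inter> coord_lattice E = M E) \<and>
      (CHAR('k) > 0 \<longrightarrow>
        lattice_colon (L \<inter> coord_lattice E) CHAR('k) = lattice_colon (M E) CHAR('k)))"
    (is "?rad \<longleftrightarrow> ?cover \<and> ?lattices")
proof -
  let ?J = "ideal_gen (binomial_of \<rho> ` u ` I)"
  have uL: "u ` I \<subseteq> L"
    using u by blast
  have M_sub: "M E \<subseteq> L \<inter> coord_lattice E" for E
    unfolding M_def
    by (rule int_lattice.sum_lattice_subset[OF int_lattice_Int[OF int_lattice_axioms int_lattice_coord_lattice]])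
      (use u in blast)
  have M: "int_lattice (M E)" "M E \<subseteq> L" for E
    using M_sub[of E] unfolding M_def by (simp_all add: int_lattice_sum_lattice)
  have U_sub: "u ` I \<inter> coord_lattice E \<subseteq> M E" for E
  proof
    fix x assume "x \<in> u ` I \<inter> coord_lattice E"
    then obtain i where "x = u i" "i \<in> {i\<in>I. u i \<in> coord_lattice E}"
      by blast
    then show "x \<in> M E"
      unfolding M_def using I by (simp only:) (rule sum_lattice_generator, simp_all)
  qed
  show ?thesis
  proof
    assume eq: ?rad
    have "binomial_of \<rho> ` L \<subseteq> ideal_radical ?J"
      unfolding eq[symmetric] lattice_ideal_def
      by (rule subset_trans[OF ideal_gen_superset subset_ideal_radical])
    then have rad: "binomial_of \<rho> v \<in> ideal_radical ?J" if "v \<in> L" for v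
      using that by (rule subsetD[OF _ imageI])
    show "?cover \<and> ?lattices"
    proof (intro conjI allI impI)
      fix E assume "\<not> (\<forall>v\<in>L. balanced E v)"
      then obtain v where v: "v \<in> L" "\<not> balanced E v"
        by blast
      show "\<exists>i\<in>I. \<not> balanced E (u i)"
      proof (rule ccontr)
        assume "\<not> ?thesis"
        then have "balanced E v"
          by (intro balanced_if_in_radical[OF uL _ v(1) rad[OF v(1)]]) blast
        then show False
          using v(2) by blast
      qed
    next
      fix E assume bal: "\<forall>v\<in>L. balanced E v" and char: "CHAR('k) = 0"
      have bal_u: "\<And>x. x \<in> u ` I \<Longrightarrow> balanced E x"
        using bal uL by blast
      show "L \<inter> coord_lattice E = M E"
        using sublattice_if_in_radical_char_0[OF char M bal_u U_sub _ _ rad] M_sub[of E] by blast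
    next
      fix E assume bal: "\<forall>v\<in>L. balanced E v" and char: "CHAR('k) > 0"
      have bal_u: "\<And>x. x \<in> u ` I \<Longrightarrow> balanced E x"
        using bal uL by blast
      show "lattice_colon (L \<inter> coord_lattice E) CHAR('k) = lattice_colon (M E) CHAR('k)"
      proof
        show "lattice_colon (M E) CHAR('k) \<subseteq> lattice_colon (L \<inter> coord_lattice E) CHAR('k)"
          using M_sub[of E] unfolding lattice_colon_def by blast
        show "lattice_colon (L \<inter> coord_lattice E) CHAR('k) \<subseteq> lattice_colon (M E) CHAR('k)"
        proof
          fix v assume "v \<in> lattice_colon (L \<inter> coord_lattice E) CHAR('k)"
          then obtain k where "int CHAR('k) ^ k *s v \<in> L \<inter> coord_lattice E"
            unfolding lattice_colon_def by blast
          then have "int CHAR('k) ^ k *s v \<in> lattice_colon (M E) CHAR('k)"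
            using sublattice_if_in_radical_char_pos[OF char M bal_u U_sub _ _ rad] by blast
          \<comment> \<open>A second power of the characteristic is harmless, since the exponents
            add up.\<close>
          then obtain l where "int CHAR('k) ^ l *s (int CHAR('k) ^ k *s v) \<in> M E"
            unfolding lattice_colon_def by blast
          then have "int CHAR('k) ^ (l + k) *s v \<in> M E"
            by (simp add: power_add)
          then show "v \<in> lattice_colon (M E) CHAR('k)"
            unfolding lattice_colon_def by blast
        qed
      qed
    qed
  next
    assume asm: "?cover \<and> ?lattices"
    have "binomial_of \<rho> ` L \<subseteq> P" if P: "prime_ideal P" and UP: "binomial_of \<rho> ` u ` I \<subseteq> P" for P
    proof
      define E where "E = {i. mvar i \<notin> P}"
      let ?G = "{v \<in> L \<inter> coord_lattice E. binomial_of \<rho> v \<in> P}"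
      interpret G: int_lattice ?G
        using P E_def by (rule int_lattice_binomial_in_prime_ideal)
      \<comment> \<open>The generators of \<open>M E\<close> have their binomials in
        \<open>P\<close>, and \<open>?G\<close> is a lattice.\<close>
      have MG: "M E \<subseteq> ?G"
        unfolding M_def using u UP by (intro G.sum_lattice_subset) auto
      have "balanced E (u i)" if "i \<in> I" for i
        unfolding E_def using P u UP that by (intro balanced_if_binomial_in_prime_ideal) auto
      then have bal: "\<forall>v\<in>L. balanced E v"
        using asm by blast
      fix b assume "b \<in> binomial_of \<rho> ` L"
      then obtain v where v: "v \<in> L" "b = binomial_of \<rho> v"
        by blast
      show "b \<in> P"
      proof (cases "v \<in> coord_lattice E")
        case True
        show ?thesis
        proof (cases "CHAR('k) = 0")
          case char: True
          then have "v \<in> M E"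
            using asm bal v(1) True by blast
          then show ?thesis
            using MG v(2) by blast
        next
          case False
          then have char: "CHAR('k) > 0" by simp
          have "int CHAR('k) ^ 0 *s v \<in> L \<inter> coord_lattice E"
            using v(1) True by simp
          then have "v \<in> lattice_colon (L \<inter> coord_lattice E) CHAR('k)"
            unfolding lattice_colon_def by blast
          then have "v \<in> lattice_colon (M E) CHAR('k)"
            using asm bal char by blast
          then obtain k where "int (CHAR('k) ^ k) *s v \<in> M E"
            unfolding lattice_colon_def of_nat_power by blast
          then have "binomial_of \<rho> (int (CHAR('k) ^ k) *s v) \<in> P"
            using MG by blast
          then have "b ^ (CHAR('k) ^ k) \<in> P"
            unfolding v(2) binomial_of_scale_CHAR_power[OF v(1) prime_CHAR_semidom[OF char] refl] .
          then show ?thesis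
            by (rule prime_ideal_power[OF P])
        qed
      next
        case False
        \<comment> \<open>Not both parts of \<open>v\<close> are supported in \<open>E\<close>,
          hence by balance neither is.\<close>
        then have "pos_part v \<notin> coord_lattice E" "neg_part v \<notin> coord_lattice E"
          using bal v(1) coord_lattice_parts_iff[of v E] by (auto simp: balanced_def)
        then have "monomial_of (pos_part v) \<in> P" "monomial_of (neg_part v) \<in> P"
          unfolding E_def
          using monomial_of_in_prime_ideal_iff[OF P pos_part_nonneg[of v]]
            monomial_of_in_prime_ideal_iff[OF P neg_part_nonneg[of v]] by blast+
        moreover have "self_module.subspace P"
          using P by (simp add: prime_ideal_def)
        ultimately show ?thesis
          unfolding v binomial_of_def
          by (intro self_module.subspace_diff self_module.subspace_scale)
      qed
    qed
    then have "ideal_radical (lattice_ideal L \<rho>) \<subseteq> ideal_radical ?J"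
      unfolding lattice_ideal_def ideal_radical_subset_iff by blast
    moreover have "ideal_radical ?J \<subseteq> ideal_radical (lattice_ideal L \<rho>)"
      unfolding lattice_ideal_def ideal_radical_subset_iff using uL by blast
    ultimately show ?rad
      by blast
  qed
qed

end

section \<open>Return to partial characters and faces of the cone\<close>

lemma partial_character_imp_lattice_character:
  assumes "partial_character L \<rho>"
  shows "lattice_character L \<rho>"
proof -
  have sub: "subgroup L int_vec_group" and hom: "\<rho> \<in> hom (int_vec_group\<lparr>carrier := L\<rparr>) units_group"
    using assms by (simp_all add: partial_character_def)
  interpret int_lattice L
    using sub by (simp add: subgroup_int_vec_group_iff)
  show ?thesis
    by unfold_locales (use hom in \<open>auto simp: hom_def units_group_def\<close>)
qed

theorem theorem3p5:
  fixes L :: "(int ^ 'm) set"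
    and \<rho> :: "int ^ 'm \<Rightarrow> 'k::field"
    and \<psi> :: "(int ^ 'm) set \<Rightarrow> int ^ 'n"
    and u :: "nat \<Rightarrow> int ^ 'm"
    and q :: nat
  assumes "partial_character L \<rho>"
    and "L \<noteq> {0}"
    and "positive_lattice L"
    and "CARD('n) = CARD('m) - lattice_rank L"
    and "\<psi> \<in> iso (int_vec_group Mod saturation L) int_vec_group"
    and "\<forall>i\<in>{1..q}. u i \<in> L"
  defines "a \<equiv> configuration L \<psi>"
  defines "\<sigma> \<equiv> rat_cone a"
  shows "ideal_radical (lattice_ideal L \<rho>) = ideal_radical (ideal_gen {binomial_of \<rho> (u i) | i. i \<in> {1..q}})
     \<longleftrightarrow>
       is_cover a u {1..q} \<and>
       (\<forall>F. is_face \<sigma> F \<longrightarrow>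
         (let Z = coord_lattice (index_set a F);
              M = sum_lattice u {i\<in>{1..q}. u i \<in> Z}
          in (CHAR('k) = 0 \<longrightarrow> L \<inter> Z = M) \<and>
             (CHAR('k) > 0 \<longrightarrow>
                lattice_colon (L \<inter> Z) CHAR('k) = lattice_colon M CHAR('k))))"
proof -
  interpret lattice_character L \<rho>
    using assms(1) by (rule partial_character_imp_lattice_character)
  have face: "(\<exists>F. is_face \<sigma> F \<and> E = index_set a F) \<longleftrightarrow> (\<forall>v\<in>L. balanced E v)" for E
    unfolding \<sigma>_def a_def ex_face_iff_lattice_face[OF assms(5)] lattice_face_iff_balanced ..
  have gens: "{binomial_of \<rho> (u i) | i. i \<in> {1..q}} = binomial_of \<rho> ` u ` {1..q}"
    by blast
  have cover: "is_cover a u {1..q} \<longleftrightarrow>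
      (\<forall>E. \<not> (\<forall>v\<in>L. balanced E v) \<longrightarrow> (\<exists>i\<in>{1..q}. \<not> balanced E (u i)))"
    unfolding is_cover_def face[unfolded \<sigma>_def] balanced_def by blast
  \<comment> \<open>Condition (ii) depends on a face only through its index set, so it may be
    quantified over balanced sets.\<close>
  have faces: "(\<forall>F. is_face \<sigma> F \<longrightarrow> Q (index_set a F)) \<longleftrightarrow> (\<forall>E. (\<forall>v\<in>L. balanced E v) \<longrightarrow> Q E)" for Q
    unfolding face[symmetric] by blast
  have "\<And>i. i \<in> {1..q} \<Longrightarrow> u i \<in> L"
    using assms(6) by blast
  note main = radical_lattice_ideal_eq_iff[OF finite_atLeastAtMost this]
  show ?thesis
    unfolding gens cover Let_def by (subst faces) (rule main)
qed

end
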